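(* Let $\gamma\in[0,\tfrac12]$, $\lambda\in(0,1]$, $\delta\in[\gamma/2,\tfrac12]$, $r=\frac{\lambda d}{\log^2 d}$, $k=d/r$, and \[p=\binom{k}{\delta k}2^{-k},\qquad q=\binom{\gamma k}{\gamma k/2}\binom{(1-\gamma)k}{(\delta-\gamma/2)k}2^{-k}.\] Run the bucketing algorithm described in the context with these $r,\delta$ and with $N=d/q$, $P=(d+1)^{r+1}$ on a uniformly random instance of $\mathcal{CP}_{d,\lambda,\gamma}$. Then the algorithm outputs a set containing the planted pair $(\vec x,\vec y)$ with probability overwhelming in $d$ (in fact at least $1-d\,e^{-d}$ for large $d$), and its expected running time is \[ \max\Big(q^{-r},\ \frac{2^{\lambda d}p^{r-1}}{q^r},\ \frac{(2^{\lambda d}p^r)^2}{q^r}\Big)^{1+o(1)}\quad (d\to\infty). \]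
   Context: All logarithms are base 2. $\mathrm{wt}$ is Hamming weight. For $\vec v\in\mathbb F_2^d$ and $I=\{i_1<\dots<i_m\}\subseteq[d]$, $\vec v_I=(v_{i_1},\dots,v_{i_m})$. For $r\mid d$ and $i\in[r]$, the $i$-th block is $B_{i,r}=[(i-1)\frac dr+1,\ i\frac dr]$. Problem $\mathcal{CP}_{d,\lambda,\gamma}$ (uniform version): the input consists of two lists $L_1=(\vec v_i)_{i\in[2^{\lambda d}]}$, $L_2=(\vec w_i)_{i\in[2^{\lambda d}]}$ of vectors in $\mathbb F_2^d$, all entries independent and uniformly random, except for one distinguished (planted) pair $(\vec x,\vec y)\in L_1\times L_2$ with $\mathrm{wt}(\vec x+\vec y)=\gamma d$; for every $i,j$ the vectors $\vec v_i,\vec w_j$ are independent. The goal is to find $(\vec x,\vec y)$ given $L_1,L_2,\gamma$. The algorithm (parameters $r\mid d$, $k=d/r$, $P,N\in\mathbb N$, $\delta\in[0,\tfrac12]$; rounding of parameters to integers is ignored): repeat $P$ times independently: pick a uniformly random permutation $\pi$ of the $d$ coordinates and apply it to every vector of both lists. Build a tree whose root (level 0) is the pair of permuted lists $(A,B)$. For each node $(A,B)$ at level $i<r$, choose $N$ independent uniform vectors $\vec z\in\mathbb F_2^k$, and for each such $\vec z$ create a child $(A',B')$ at level $i+1$, where $A'=\{\vec v\in A:\mathrm{wt}(\vec v_{B_{i+1,r}}+\vec z)=\delta k\}$ and $B'=\{\vec w\in B:\mathrm{wt}(\vec w_{B_{i+1,r}}+\vec z)=\delta k\}$. For each leaf $(A,B)$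 at level $r$, compare all pairs in $A\times B$ and output those $(\vec v,\vec w)$ with $\mathrm{wt}(\vec v+\vec w)=\gamma d$ (undoing $\pi$). The output is the union over all repetitions. Running time counts all list scans, node creations (every tree node costs at least one step) and pairwise comparisons (each costing $\mathrm{poly}(d)$). "Overwhelming in $d$" means $1$ minus a function that is eventually smaller than every inverse polynomial in $d$. *)

theory Defs
  imports "HOL-Probability.Probability"
begin

text \<open>Vectors in F_2^d are boolean lists of length d; addition is coordinatewise xor.\<close>

definition vadd :: "bool list \<Rightarrow> bool list \<Rightarrow> bool list" where
  "vadd v w = map2 (\<noteq>) v w"

definition wt :: "bool list \<Rightarrow> nat" where
  "wt v = length (filter id v)"

definition vec_pmf :: "nat \<Rightarrow> bool list pmf" where
  "vec_pmf d = replicate_pmf d (pmf_of_set (UNIV :: bool set))"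

text \<open>The (i+1)-th block of size k (0-indexed level i), i.e. coordinates
  [i*k, (i+1)*k) in 0-based indexing = B_{i+1,r} of the paper.\<close>
definition block :: "nat \<Rightarrow> nat \<Rightarrow> bool list \<Rightarrow> bool list" where
  "block i k v = take k (drop (i * k) v)"

definition cp_instance :: "nat \<Rightarrow> nat \<Rightarrow> nat \<Rightarrow>
    ((bool list list \<times> bool list list) \<times> (bool list \<times> bool list)) pmf" where
  "cp_instance d n w = do {
     L1 \<leftarrow> replicate_pmf n (vec_pmf d);
     L2 \<leftarrow> replicate_pmf n (vec_pmf d);
     x \<leftarrow> vec_pmf d;
     y \<leftarrow> pmf_of_set {y. length y = d \<and> wt (vadd x y) = w};
     i \<leftarrow> pmf_of_set {..<n};
     j \<leftarrow> pmf_of_set {..<n};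
     return_pmf ((L1[i := x], L2[j := y]), (x, y)) }"

text \<open>Lists of a node store pairs (original vector, permuted vector); the
  output pairs are the original vectors (undoing pi).  A run returns the set of
  output pairs together with its cost.  Cost model: every node costs 1; an
  inner node with lists A,B creating N children costs N*(|A|+|B|) for the
  scans; a leaf costs |A|*|B|*d (each comparison costs d).
  Arguments: remaining depth m, dimension d, block size k, bucket weight t
  (= delta k), number of children N, target weight w, current level i.\<close>
primrec bucket_tree :: "nat \<Rightarrow> nat \<Rightarrow> nat \<Rightarrow> nat \<Rightarrow> nat \<Rightarrow> nat \<Rightarrow> nat \<Rightarrow>
    (bool list \<times> bool list) list \<Rightarrow> (bool list \<times> bool list) list \<Rightarrow>
    ((bool list \<times> bool list) set \<times> nat) pmf" where
  "bucket_tree 0 d k t N w i A B =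
     return_pmf ({(fst a, fst b) | a b. a \<in> set A \<and> b \<in> set B \<and> wt (vadd (snd a) (snd b)) = w},
                 1 + length A * length B * d)"
| "bucket_tree (Suc m) d k t N w i A B = do {
     cs \<leftarrow> replicate_pmf N (do {
             z \<leftarrow> vec_pmf k;
             bucket_tree m d k t N w (Suc i)
               (filter (\<lambda>a. wt (vadd (block i k (snd a)) z) = t) A)
               (filter (\<lambda>b. wt (vadd (block i k (snd b)) z) = t) B) });
     return_pmf (\<Union> (set (map fst cs)), 1 + N * (length A + length B) + sum_list (map snd cs)) }"

text \<open>One repetition: random permutation of the coordinates (cost of applying
  it: d per vector), then a tree of depth r.\<close>
definition repetition :: "nat \<Rightarrow> nat \<Rightarrow> nat \<Rightarrow> nat \<Rightarrow> nat \<Rightarrow> nat \<Rightarrow>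
    bool list list \<Rightarrow> bool list list \<Rightarrow> ((bool list \<times> bool list) set \<times> nat) pmf" where
  "repetition d r k t N w L1 L2 = do {
     \<pi> \<leftarrow> pmf_of_set {\<pi>. \<pi> permutes {..<d}};
     (out, c) \<leftarrow> bucket_tree r d k t N w 0
                   (map (\<lambda>v. (v, map (\<lambda>j. v ! \<pi> j) [0..<d])) L1)
                   (map (\<lambda>v. (v, map (\<lambda>j. v ! \<pi> j) [0..<d])) L2);
     return_pmf (out, c + (length L1 + length L2) * d) }"

definition bucket_alg :: "nat \<Rightarrow> nat \<Rightarrow> nat \<Rightarrow> nat \<Rightarrow> nat \<Rightarrow> nat \<Rightarrow> nat \<Rightarrow>
    bool list list \<Rightarrow> bool list list \<Rightarrow> ((bool list \<times> bool list) set \<times> nat) pmf" where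
  "bucket_alg d r k t N w P L1 L2 = do {
     reps \<leftarrow> replicate_pmf P (repetition d r k t N w L1 L2);
     return_pmf (\<Union> (set (map fst reps)), sum_list (map snd reps)) }"

text \<open>With (integer) block size k, t = delta k and h = gamma k / 2:\<close>
definition p_val :: "nat \<Rightarrow> nat \<Rightarrow> real" where
  "p_val k t = real (k choose t) / 2 ^ k"

definition q_val :: "nat \<Rightarrow> nat \<Rightarrow> nat \<Rightarrow> real" where
  "q_val k t h = real ((2 * h) choose h) * real ((k - 2 * h) choose (t - h)) / 2 ^ k"

text \<open>Full experiment on dimension d, with number of blocks r, h = gamma k/2,
  t = delta k, list length n (= 2^(lambda d)); k = d/r, planted weight
  gamma d = r * gamma k = 2 r h, N = d/q (rounded up), P = (d+1)^(r+1).
  Returns (planted pair is in the output, running time).\<close>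
definition cp_run :: "nat \<Rightarrow> nat \<Rightarrow> nat \<Rightarrow> nat \<Rightarrow> nat \<Rightarrow> (bool \<times> nat) pmf" where
  "cp_run d r h t n = (let k = d div r; w = 2 * r * h;
       N = nat \<lceil>real d / q_val k t h\<rceil>; P = (d + 1) ^ (r + 1) in
     do {
       (I, xy) \<leftarrow> cp_instance d n w;
       (out, c) \<leftarrow> bucket_alg d r k t N w P (fst I) (snd I);
       return_pmf (xy \<in> out, c) })"

definition success_prob :: "nat \<Rightarrow> nat \<Rightarrow> nat \<Rightarrow> nat \<Rightarrow> nat \<Rightarrow> real" where
  "success_prob d r h t n = measure_pmf.prob (cp_run d r h t n) {z. fst z}"

definition expected_time :: "nat \<Rightarrow> nat \<Rightarrow> nat \<Rightarrow> nat \<Rightarrow> nat \<Rightarrow> real" where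
  "expected_time d r h t n = measure_pmf.expectation (cp_run d r h t n) (\<lambda>z. real (snd z))"

definition time_bound :: "real \<Rightarrow> nat \<Rightarrow> nat \<Rightarrow> nat \<Rightarrow> nat \<Rightarrow> real" where
  "time_bound lam d r h t = (let k = d div r; p = p_val k t; q = q_val k t h in
     max (inverse (q ^ r))
       (max (2 powr (lam * real d) * p ^ (r - 1) / q ^ r)
            ((2 powr (lam * real d) * p ^ r)\<^sup>2 / q ^ r)))"

end

theory Submission
  imports Defs "HOL-Real_Asymp.Real_Asymp"
begin

text \<open>For fixed lists, a uniformly random bucket centre catches a single vector with probability
  \<open>p\<close>, so the expected cost of one tree splits into node creations, scans, and a sum over pairs of
  the probability that a pair stays together along a path. This last probability averages to
  \<open>p\<^sup>2\<^sup>r\<close> for every pair except the planted one, for which it is at most \<open>p\<^sup>r\<close>. Hence the expected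
  time is at least the time bound \<open>T\<close>, and at most \<open>(d + 1)\<^bsup>3r+3\<^esup> T\<close>. Since \<open>q \<le> p\<close> gives
  \<open>T \<ge> 2\<^bsup>\<lambda>d\<^esup>\<close> and \<open>r log d = o(d)\<close>, the overhead is \<open>T\<^bsup>o(1)\<^esup>\<close>.

  A permutation spreads the differences of the planted pair evenly over the blocks with probability
  \<open>(k choose 2h)\<^sup>r / (d choose 2hr) \<ge> (k + 1)\<^bsup>-r\<^esup>\<close>, because \<open>2h\<close> is the mode of the binomial
  distribution with \<open>k\<close> trials and mean \<open>2h\<close>. Given this, each level keeps the pair together in one
  of its \<open>N\<close> children except with probability \<open>(1 - q)\<^sup>N \<le> e\<^bsup>-d\<^esup>\<close>.\<close>

subsection \<open>Uniform vectors and random buckets\<close>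

text \<open>Both sides are the integral over one independent pair of draws, and the two draws
  commute in the monad.\<close>

lemma nn_integral_pmf_swap:
  "(\<integral>\<^sup>+x. \<integral>\<^sup>+y. f x y \<partial>measure_pmf B \<partial>measure_pmf A) = (\<integral>\<^sup>+y. \<integral>\<^sup>+x. f x y \<partial>measure_pmf A \<partial>measure_pmf B)"
proof -
  have "(\<integral>\<^sup>+x. \<integral>\<^sup>+y. f x y \<partial>measure_pmf B \<partial>measure_pmf A) =
     (\<integral>\<^sup>+z. f (fst z) (snd z) \<partial>measure_pmf (bind_pmf A (\<lambda>x. bind_pmf B (\<lambda>y. return_pmf (x, y)))))"
    by simp
  also have "\<dots> = (\<integral>\<^sup>+y. \<integral>\<^sup>+x. f x y \<partial>measure_pmf A \<partial>measure_pmf B)"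
    by (subst bind_commute_pmf) simp
  finally show ?thesis .
qed

lemma nn_integral_sum_list:
  "(\<integral>\<^sup>+z. (\<Sum>a\<leftarrow>xs. f a z) \<partial>measure_pmf M) = (\<Sum>a\<leftarrow>xs. \<integral>\<^sup>+z. f a z \<partial>measure_pmf M)"
  by (induction xs) (simp_all add: nn_integral_add)

lemma nn_integral_replicate_pmf_nth:
  "u < n \<Longrightarrow> (\<integral>\<^sup>+L. f (L ! u) \<partial>measure_pmf (replicate_pmf n p)) = (\<integral>\<^sup>+x. f x \<partial>measure_pmf p)"
proof (induction n arbitrary: u)
  case (Suc n)
  then show ?case by (cases u) simp_all
qed simp

lemma nn_integral_replicate_pmf_sum_list:
  fixes f :: "'a \<Rightarrow> ennreal"
  shows "(\<integral>\<^sup>+xs. sum_list (map f xs) \<partial>measure_pmf (replicate_pmf N p)) = of_nat N * (\<integral>\<^sup>+x. f x \<partial>measure_pmf p)"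
  by (induction N) (simp_all add: nn_integral_add distrib_right)

lemma emeasure_replicate_pmf_all:
  "emeasure (measure_pmf (replicate_pmf N p)) {xs. \<forall>x\<in>set xs. Q x} = emeasure (measure_pmf p) {x. Q x} ^ N"
proof (induction N)
  case (Suc N)
  have "indicator {xs. \<forall>x\<in>set xs. Q x} (x # xs) =
      indicator {x. Q x} x * (indicator {xs. \<forall>x\<in>set xs. Q x} xs :: ennreal)" for x xs
    by (auto simp: indicator_def)
  then show ?case
    using Suc by (simp add: nn_integral_cmult nn_integral_multc)
qed (simp add: indicator_def)

lemma finite_lists_length [simp]: "finite {v :: bool list. length v = k}"
  and card_lists_length [simp]: "card {v :: bool list. length v = k} = 2 ^ k"
  using finite_lists_length_eq[of "UNIV :: bool set" k] card_lists_length_eq[of "UNIV :: bool set" k]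
  by auto

text \<open>Discharges the nonemptiness conditions of \<open>pmf_of_set\<close> on the vectors of a
  fixed length.\<close>

declare Ex_list_of_length [simp]

lemma pair_pmf_of_set:
  assumes "finite A" "A \<noteq> {}" "finite B" "B \<noteq> {}"
  shows "pair_pmf (pmf_of_set A) (pmf_of_set B) = pmf_of_set (A \<times> B)"
proof (rule pmf_eqI)
  fix x
  show "pmf (pair_pmf (pmf_of_set A) (pmf_of_set B)) x = pmf (pmf_of_set (A \<times> B)) x"
    using assms by (cases x) (simp add: pmf_pair card_cartesian_product indicator_def)
qed

text \<open>Independent fair coordinates give equal mass to all vectors. In this form probabilities
  become cardinalities, and every bijection of the cube preserves the law.\<close>

lemma vec_pmf_eq: "vec_pmf k = pmf_of_set {v. length v = k}"
proof (induction k)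
  case 0
  have "{v :: bool list. length v = 0} = {[]}" by auto
  then show ?case by (simp add: vec_pmf_def pmf_of_set_singleton)
next
  case (Suc k)
  have "vec_pmf (Suc k) = map_pmf (\<lambda>(x, xs). x # xs) (pair_pmf (pmf_of_set UNIV) (vec_pmf k))"
    by (simp add: vec_pmf_def pair_pmf_def map_bind_pmf)
  also have "\<dots> = map_pmf (\<lambda>(x, xs). x # xs) (pmf_of_set (UNIV \<times> {v. length v = k}))"
    by (simp add: Suc pair_pmf_of_set)
  also have "\<dots> = pmf_of_set {v. length v = Suc k}"
  proof (rule map_pmf_of_set_bij_betw)
    show "bij_betw (\<lambda>(x, xs). x # xs) (UNIV \<times> {v :: bool list. length v = k}) {v. length v = Suc k}"
      by (auto simp: bij_betw_def inj_on_def image_def length_Suc_conv)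
  qed auto
  finally show ?case .
qed

lemma set_vec_pmf [simp]: "set_pmf (vec_pmf k) = {v. length v = k}"
  unfolding vec_pmf_eq by (rule set_pmf_of_set) auto

lemma vec_pmf_append: "vec_pmf (k + m) = do {a \<leftarrow> vec_pmf k; b \<leftarrow> vec_pmf m; return_pmf (a @ b)}"
  by (simp add: vec_pmf_def replicate_pmf_distrib)

lemma map_vec_pmf_bij:
  assumes "bij_betw f {v. length v = k} {v. length v = k}"
  shows "map_pmf f (vec_pmf k) = vec_pmf k"
  unfolding vec_pmf_eq by (rule map_pmf_of_set_bij_betw[OF assms]) auto

lemma length_vadd [simp]: "length (vadd v w) = min (length v) (length w)"
  by (simp add: vadd_def)

lemma nth_vadd [simp]: "i < length v \<Longrightarrow> i < length w \<Longrightarrow> vadd v w ! i = (v ! i \<noteq> w ! i)"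
  by (simp add: vadd_def)

lemma vadd_commute: "length v = length w \<Longrightarrow> vadd v w = vadd w v"
  by (rule nth_equalityI) auto

lemma wt_conv_card: "wt v = card {i. i < length v \<and> v ! i}"
  by (simp add: wt_def length_filter_conv_card)

text \<open>Turns bucket centres into sets: relative to a fixed \<open>a\<close>, the centre
  \<open>vadd a (char_vec k U)\<close> is the vector that differs from \<open>a\<close> exactly on
  \<open>U\<close>.\<close>

definition char_vec :: "nat \<Rightarrow> nat set \<Rightarrow> bool list" where
  "char_vec k U = map (\<lambda>i. i \<in> U) [0..<k]"

lemma length_char_vec [simp]: "length (char_vec k U) = k"
  and nth_char_vec [simp]: "i < k \<Longrightarrow> char_vec k U ! i \<longleftrightarrow> i \<in> U"
  by (simp_all add: char_vec_def)

lemma bij_betw_vadd_char_vec: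
  assumes "length a = k"
  shows "bij_betw (\<lambda>U. vadd a (char_vec k U)) (Pow {..<k}) {v. length v = k}"
proof (rule bij_betw_byWitness[where f' = "\<lambda>v. {i. i < k \<and> a ! i \<noteq> v ! i}"])
  show "\<forall>U\<in>Pow {..<k}. {i. i < k \<and> a ! i \<noteq> vadd a (char_vec k U) ! i} = U"
    using assms by auto
  show "\<forall>v\<in>{v. length v = k}. vadd a (char_vec k {i. i < k \<and> a ! i \<noteq> v ! i}) = v"
    using assms by (auto intro!: nth_equalityI)
qed (use assms in auto)

text \<open>Over the field with two elements, \<open>b\<close> plus \<open>a\<close> is the
  indicator of \<open>E\<close>, so adding the indicator of \<open>U\<close> leaves the indicator of
  the symmetric difference.\<close>

lemma wt_vadd_shift:
  assumes "length a = k" "length b = k" "U \<subseteq> {..<k}"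
  defines "E \<equiv> {i. i < k \<and> a ! i \<noteq> b ! i}"
  shows "wt (vadd b (vadd a (char_vec k U))) = card ((E - U) \<union> (U - E))"
  unfolding wt_conv_card using assms by (intro arg_cong[where f = card]) auto

lemma prob_vec_pmf:
  "measure_pmf.prob (vec_pmf k) {z. P z} = real (card {z. length z = k \<and> P z}) / 2 ^ k"
  unfolding vec_pmf_eq by (subst measure_pmf_of_set) (simp_all add: Int_def)

text \<open>The centres at distance \<open>t\<close> from \<open>a\<close> correspond to the
  \<open>t\<close>-element sets of coordinates, so their number does not depend on
  \<open>a\<close>.\<close>

lemma prob_wt_vadd:
  assumes "length a = k"
  shows "measure_pmf.prob (vec_pmf k) {z. wt (vadd a z) = t} = p_val k t"
proof -
  have "bij_betw (\<lambda>U. vadd a (char_vec k U)) {U \<in> Pow {..<k}. card U = t} {z \<in> {v. length v = k}. wt (vadd a z) = t}"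
    using bij_betw_vadd_char_vec[OF assms]
  proof (rule bij_betw_Collect)
    fix U assume "U \<in> Pow {..<k}"
    then show "(wt (vadd a (vadd a (char_vec k U))) = t) = (card U = t)"
      using wt_vadd_shift[of a k a U] assms by simp
  qed
  then have "card {z. length z = k \<and> wt (vadd a z) = t} = card {U. U \<subseteq> {..<k} \<and> card U = t}"
    by (auto simp: Pow_def dest!: bij_betw_same_card)
  then show ?thesis
    by (simp add: prob_vec_pmf p_val_def n_subsets)
qed

section \<open>Buckets that catch both vectors of a pair\<close>

definition pair_prob :: "nat \<Rightarrow> nat \<Rightarrow> bool list \<Rightarrow> bool list \<Rightarrow> real" where
  "pair_prob k t a b = measure_pmf.prob (vec_pmf k) {z. wt (vadd a z) = t \<and> wt (vadd b z) = t}"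

lemma pair_prob_le:
  assumes "length a = k"
  shows "pair_prob k t a b \<le> p_val k t"
  unfolding pair_prob_def prob_wt_vadd[OF assms, symmetric]
  by (rule measure_pmf.finite_measure_mono) auto

text \<open>A centre that differs from \<open>a\<close> on \<open>h\<close> of the
  \<open>2 * h\<close> points of \<open>E\<close> and on \<open>t - h\<close> points outside
  \<open>E\<close> has distance \<open>t\<close> from both vectors. The numerator of
  \<open>q_val\<close> counts these centres.\<close>

lemma pair_prob_ge:
  assumes "length a = k" "length b = k" "wt (vadd a b) = 2 * h" "h \<le> t"
  shows "q_val k t h \<le> pair_prob k t a b"
proof -
  define E where "E = {i. i < k \<and> a ! i \<noteq> b ! i}"
  have E: "card E = 2 * h" "E \<subseteq> {..<k}" "finite E"
  proof -
    have "E = {i. i < length (vadd a b) \<and> vadd a b ! i}" using assms(1,2) by (auto simp: E_def)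
    then show "card E = 2 * h" using assms(3) by (simp add: wt_conv_card)
  qed (auto simp: E_def)
  let ?X = "{X. X \<subseteq> E \<and> card X = h}" and ?Y = "{Y. Y \<subseteq> {..<k} - E \<and> card Y = t - h}"
  let ?Z = "{z. length z = k \<and> wt (vadd a z) = t \<and> wt (vadd b z) = t}"
  let ?f = "\<lambda>(X, Y). vadd a (char_vec k (X \<union> Y))"
  have "inj_on ?f (?X \<times> ?Y)"
  proof (rule inj_onI; clarify)
    fix X Y X' Y'
    assume *: "X \<subseteq> E" "Y \<subseteq> {..<k} - E" "X' \<subseteq> E" "Y' \<subseteq> {..<k} - E"
      "vadd a (char_vec k (X \<union> Y)) = vadd a (char_vec k (X' \<union> Y'))"
    then have "X \<union> Y = X' \<union> Y'"
      using E bij_betw_imp_inj_on[OF bij_betw_vadd_char_vec[OF assms(1)]]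
      by (auto dest!: inj_onD)
    then show "X = X' \<and> Y = Y'" using * by blast
  qed
  moreover have "?f ` (?X \<times> ?Y) \<subseteq> ?Z"
  proof clarify
    fix X Y assume X: "X \<subseteq> E" "h = card X" and Y: "Y \<subseteq> {..<k} - E" "card Y = t - card X"
    have fin: "finite X" "finite Y" using X Y E finite_subset by (blast, metis finite_Diff finite_lessThan finite_subset)
    have "card (X \<union> Y) = t" using X Y assms(4) fin by (subst card_Un_disjoint) auto
    \<comment> \<open>Seen from \<open>b\<close>, the centre differs on \<open>E - X\<close> in
      place of \<open>X\<close>. Both have \<open>h\<close> elements, so the distance is
      \<open>t\<close> again.\<close>
    moreover have "(E - (X \<union> Y)) \<union> ((X \<union> Y) - E) = (E - X) \<union> Y" using X Y by auto
    moreover have "card ((E - X) \<union> Y) = t"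
      using X Y assms(4) fin E by (subst card_Un_disjoint) (auto simp: card_Diff_subset)
    ultimately show "length (vadd a (char_vec k (X \<union> Y))) = k \<and>
        wt (vadd a (vadd a (char_vec k (X \<union> Y)))) = t \<and> wt (vadd b (vadd a (char_vec k (X \<union> Y)))) = t"
      using wt_vadd_shift[of a k a "X \<union> Y"] wt_vadd_shift[of a k b "X \<union> Y"] assms X Y E
      by (auto simp: E_def)
  qed
  moreover have "finite ?Z" by (rule finite_subset[OF _ finite_lists_length[of k]]) auto
  ultimately have "card (?X \<times> ?Y) \<le> card ?Z" by (rule card_inj_on_le)
  moreover have "card (?X \<times> ?Y) = ((2 * h) choose h) * ((k - 2 * h) choose (t - h))"
    using E by (simp add: card_cartesian_product n_subsets card_Diff_subset)
  ultimately show ?thesis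
    unfolding pair_prob_def prob_vec_pmf q_val_def
    by (simp add: divide_right_mono flip: of_nat_mult)
qed

lemma q_val_nonneg [simp]: "0 \<le> q_val k t h" and p_val_nonneg [simp]: "0 \<le> p_val k t"
  by (simp_all add: q_val_def p_val_def)

text \<open>Compared through one explicit pair at distance \<open>2 * h\<close>, the zero vector and
  the indicator of the first \<open>2 * h\<close> coordinates: catching both is at most as likely as
  catching one.\<close>

lemma q_val_le_p_val:
  assumes "2 * h \<le> k" "h \<le> t"
  shows "q_val k t h \<le> p_val k t"
proof -
  have "{i. i < k \<and> i < 2 * h} = {..<2 * h}" using assms by auto
  then have "wt (vadd (char_vec k {}) (char_vec k {..<2 * h})) = 2 * h"
    by (simp add: wt_conv_card cong: conj_cong)
  then have "q_val k t h \<le> pair_prob k t (char_vec k {}) (char_vec k {..<2 * h})"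
    using assms by (intro pair_prob_ge) auto
  also have "\<dots> \<le> p_val k t" by (rule pair_prob_le) simp
  finally show ?thesis .
qed

lemma p_val_le_1: "p_val k t \<le> 1"
  using prob_wt_vadd[of "char_vec k {}" k t] by (metis length_char_vec measure_pmf.prob_le_1)

subsection \<open>Expected cost on fixed lists\<close>

text \<open>The centres along a root-to-leaf path are independent, so this product is the
  probability that a pair survives together through the \<open>m\<close> levels from level
  \<open>i\<close> on.\<close>

definition path_prob :: "nat \<Rightarrow> nat \<Rightarrow> nat \<Rightarrow> nat \<Rightarrow> bool list \<Rightarrow> bool list \<Rightarrow> real" where
  "path_prob m k t i a b = (\<Prod>j<m. pair_prob k t (block (i + j) k a) (block (i + j) k b))"

lemma pair_prob_nonneg [simp]: "0 \<le> pair_prob k t a b"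
  by (simp add: pair_prob_def)

lemma path_prob_nonneg [simp]: "0 \<le> path_prob m k t i a b"
  by (simp add: path_prob_def prod_nonneg)

lemma path_prob_0 [simp]: "path_prob 0 k t i a b = 1"
  and path_prob_Suc: "path_prob (Suc m) k t i a b =
    pair_prob k t (block i k a) (block i k b) * path_prob m k t (Suc i) a b"
  unfolding path_prob_def by (simp_all only: prod.lessThan_Suc_shift) simp_all

definition node_count :: "nat \<Rightarrow> nat \<Rightarrow> real" where
  "node_count N m = (\<Sum>j\<le>m. real N ^ j)"

text \<open>The factor of the list lengths in the expected scan cost: level \<open>j\<close> has
  \<open>N ^ j\<close> nodes, each holding an expected fraction \<open>p ^ j\<close> of a list and
  scanning it \<open>N\<close> times.\<close>

definition scan_count :: "nat \<Rightarrow> real \<Rightarrow> nat \<Rightarrow> real" where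
  "scan_count N p m = (\<Sum>j<m. real N ^ Suc j * p ^ j)"

lemma node_count_nonneg: "0 \<le> node_count N m" and scan_count_nonneg: "0 \<le> p \<Longrightarrow> 0 \<le> scan_count N p m"
  by (simp_all add: node_count_def scan_count_def sum_nonneg)

lemma node_count_Suc: "node_count N (Suc m) = 1 + real N * node_count N m"
  unfolding node_count_def by (simp add: sum.atMost_Suc_shift sum_distrib_left del: sum.atMost_Suc)

lemma scan_count_Suc: "scan_count N p (Suc m) = real N + real N * p * scan_count N p m"
  unfolding scan_count_def
  by (simp add: sum.lessThan_Suc_shift sum_distrib_left algebra_simps del: sum.lessThan_Suc)

lemma of_nat_sum_list: "of_nat (sum_list xs) = (\<Sum>x\<leftarrow>xs. of_nat x)"
  by (induction xs) simp_all

lemma length_filter_conv_sum_list: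
  "(of_nat (length (filter P xs)) :: 'a :: semiring_1) = (\<Sum>x\<leftarrow>xs. of_bool (P x))"
  by (induction xs) auto

lemma nn_integral_of_bool:
  "(\<integral>\<^sup>+x. of_bool (P x) \<partial>measure_pmf M) = ennreal (measure_pmf.prob M {x. P x})"
proof -
  have "(\<integral>\<^sup>+x. of_bool (P x) \<partial>measure_pmf M) = (\<integral>\<^sup>+x. indicator {x. P x} x \<partial>measure_pmf M)"
    by (intro nn_integral_cong) (simp add: indicator_def)
  then show ?thesis by (simp add: measure_pmf.emeasure_eq_measure)
qed

lemma nn_integral_length_bucket:
  assumes "\<And>a. a \<in> set A \<Longrightarrow> length (f a) = k"
  shows "(\<integral>\<^sup>+z. of_nat (length (filter (\<lambda>a. wt (vadd (f a) z) = t) A)) \<partial>measure_pmf (vec_pmf k))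
    = ennreal (p_val k t) * of_nat (length A)"
proof -
  have "(\<Sum>a\<leftarrow>A. \<integral>\<^sup>+z. of_bool (wt (vadd (f a) z) = t) \<partial>measure_pmf (vec_pmf k)) =
      (\<Sum>a\<leftarrow>A. ennreal (p_val k t))"
    by (intro arg_cong[where f = sum_list] map_cong) (auto simp: nn_integral_of_bool prob_wt_vadd assms)
  then show ?thesis
    by (simp add: length_filter_conv_sum_list nn_integral_sum_list sum_list_triv mult.commute)
qed

text \<open>Both filters use the same centre \<open>z\<close>, so a pair is weighted by the joint
  probability \<open>pair_prob\<close> and not by a product of two single probabilities.\<close>

lemma nn_integral_pairs_bucket:
  fixes G :: "'a \<Rightarrow> 'b \<Rightarrow> ennreal"
  shows "(\<integral>\<^sup>+z. (\<Sum>a\<leftarrow>filter (\<lambda>a. wt (vadd (f a) z) = t) A. \<Sum>b\<leftarrow>filter (\<lambda>b. wt (vadd (g b) z) = t) B. G a b)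
      \<partial>measure_pmf (vec_pmf k)) = (\<Sum>a\<leftarrow>A. \<Sum>b\<leftarrow>B. ennreal (pair_prob k t (f a) (g b)) * G a b)"
proof -
  have "(\<Sum>a\<leftarrow>filter (\<lambda>a. wt (vadd (f a) z) = t) A. \<Sum>b\<leftarrow>filter (\<lambda>b. wt (vadd (g b) z) = t) B. G a b)
      = (\<Sum>a\<leftarrow>A. \<Sum>b\<leftarrow>B. of_bool (wt (vadd (f a) z) = t \<and> wt (vadd (g b) z) = t) * G a b)" for z
    unfolding sum_list_map_filter'
    by (intro arg_cong[where f = sum_list] map_cong) (auto simp: sum_list_0 intro!: arg_cong[where f = sum_list] map_cong)
  then show ?thesis
    by (simp add: nn_integral_sum_list nn_integral_multc nn_integral_of_bool pair_prob_def)
qed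

text \<open>Induction on the depth. By linearity the \<open>N\<close> children cost \<open>N\<close>
  times one child, whose lists have expected lengths shrunk by \<open>p_val k t\<close>. Only the
  comparison term depends on the vectors themselves, through the pairs that stay together, and is
  kept as a sum over pairs.\<close>

lemma nn_integral_bucket_tree_cost:
  assumes "\<And>a j. a \<in> snd ` (set A \<union> set B) \<Longrightarrow> j < m \<Longrightarrow> length (block (i + j) k a) = k"
  shows "(\<integral>\<^sup>+x. of_nat (snd x) \<partial>measure_pmf (bucket_tree m d k t N w i A B)) =
    ennreal (node_count N m) + ennreal (scan_count N (p_val k t) m) * (of_nat (length A) + of_nat (length B))
    + ennreal (real d * real N ^ m) * (\<Sum>a\<leftarrow>A. \<Sum>b\<leftarrow>B. ennreal (path_prob m k t i (snd a) (snd b)))"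
  using assms
proof (induction m arbitrary: i A B)
  case 0
  show ?case
    by (simp add: node_count_def scan_count_def sum_list_triv ennreal_of_nat_eq_real_of_nat
        flip: ennreal_mult' ennreal_plus) (simp add: mult_ac)
next
  case (Suc m)
  let ?A = "\<lambda>z. filter (\<lambda>a. wt (vadd (block i k (snd a)) z) = t) A"
  let ?B = "\<lambda>z. filter (\<lambda>b. wt (vadd (block i k (snd b)) z) = t) B"
  let ?p = "p_val k t"
  have IH: "(\<integral>\<^sup>+x. of_nat (snd x) \<partial>measure_pmf (bucket_tree m d k t N w (Suc i) (?A z) (?B z))) =
    ennreal (node_count N m) + ennreal (scan_count N ?p m) * (of_nat (length (?A z)) + of_nat (length (?B z)))
    + ennreal (real d * real N ^ m) * (\<Sum>a\<leftarrow>?A z. \<Sum>b\<leftarrow>?B z. ennreal (path_prob m k t (Suc i) (snd a) (snd b)))" for z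
  proof (rule Suc.IH)
    fix a j assume "a \<in> snd ` (set (?A z) \<union> set (?B z))" "j < m"
    then show "length (block (Suc i + j) k a) = k"
      using Suc.prems[of a "Suc j"] by auto
  qed
  have lenA: "length (block i k (snd a)) = k" if "a \<in> set A" for a
    using Suc.prems[of "snd a" 0] that by auto
  have lenB: "length (block i k (snd b)) = k" if "b \<in> set B" for b
    using Suc.prems[of "snd b" 0] that by auto
  have "(\<integral>\<^sup>+x. of_nat (snd x) \<partial>measure_pmf (bucket_tree (Suc m) d k t N w i A B)) =
    of_nat (1 + N * (length A + length B)) + of_nat N *
     (\<integral>\<^sup>+z. (\<integral>\<^sup>+x. of_nat (snd x) \<partial>measure_pmf (bucket_tree m d k t N w (Suc i) (?A z) (?B z))) \<partial>measure_pmf (vec_pmf k))"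
    (is "_ = _ + of_nat N * ?I")
  proof -
    let ?M = "vec_pmf k \<bind> (\<lambda>z. bucket_tree m d k t N w (Suc i) (?A z) (?B z))"
    have "(\<integral>\<^sup>+x. of_nat (snd x) \<partial>measure_pmf (bucket_tree (Suc m) d k t N w i A B)) =
      (\<integral>\<^sup>+xs. of_nat (1 + N * (length A + length B)) + (\<Sum>x\<leftarrow>xs. of_nat (snd x)) \<partial>measure_pmf (replicate_pmf N ?M))"
      by (simp add: of_nat_sum_list comp_def add.assoc)
    also have "\<dots> = of_nat (1 + N * (length A + length B)) + of_nat N * (\<integral>\<^sup>+x. of_nat (snd x) \<partial>measure_pmf ?M)"
      by (subst nn_integral_add) (simp_all only: nn_integral_replicate_pmf_sum_list, simp_all)
    finally show ?thesis by simp
  qed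
  \<comment> \<open>Averaging the induction hypothesis over \<open>z\<close> multiplies each length
    by \<open>p_val k t\<close> and extends each path by the pair probability of block
    \<open>i\<close>.\<close>
  also have "?I = ennreal (node_count N m) +
      ennreal (scan_count N ?p m) * (ennreal ?p * of_nat (length A) + ennreal ?p * of_nat (length B)) +
      ennreal (real d * real N ^ m) * (\<Sum>a\<leftarrow>A. \<Sum>b\<leftarrow>B. ennreal (path_prob (Suc m) k t i (snd a) (snd b)))"
    unfolding IH
    by (simp add: nn_integral_add nn_integral_cmult nn_integral_length_bucket lenA lenB
        nn_integral_pairs_bucket path_prob_Suc ennreal_mult' del: sum_list_ennreal)
  finally show ?case
    by (simp add: node_count_Suc scan_count_Suc node_count_nonneg scan_count_nonneg ennreal_mult'
        ennreal_of_nat_eq_real_of_nat[symmetric] ennreal_power[symmetric] algebra_simps)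
qed

subsection \<open>Expected cost on a random instance\<close>

lemma nn_integral_cong_pmf:
  "(\<And>x. x \<in> set_pmf M \<Longrightarrow> f x = g x) \<Longrightarrow> (\<integral>\<^sup>+x. f x \<partial>measure_pmf M) = (\<integral>\<^sup>+x. g x \<partial>measure_pmf M)"
  by (intro nn_integral_cong_AE) (simp add: AE_measure_pmf_iff)

lemma pair_prob_commute: "pair_prob k t a b = pair_prob k t b a"
  by (simp add: pair_prob_def conj_commute)

lemma path_prob_commute: "path_prob m k t i a b = path_prob m k t i b a"
  by (simp add: path_prob_def pair_prob_commute)

text \<open>Meant for the planted pair, whose vectors are correlated: at each level, catching both
  is bounded by catching the first.\<close>

lemma path_prob_le:
  assumes "\<And>j. j < m \<Longrightarrow> length (block (i + j) k a) = k"
  shows "path_prob m k t i a b \<le> p_val k t ^ m"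
proof -
  have "path_prob m k t i a b \<le> (\<Prod>j<m. p_val k t)"
    unfolding path_prob_def by (intro prod_mono) (auto intro!: pair_prob_le assms)
  then show ?thesis by simp
qed

text \<open>Exchange the draws of \<open>a\<close> and of the centre. For every fixed centre the
  uniform \<open>a\<close> is caught with probability \<open>p_val k t\<close>, whether or not
  \<open>b\<close> is caught.\<close>

lemma nn_integral_pair_prob:
  assumes "length b = k"
  shows "(\<integral>\<^sup>+a. ennreal (pair_prob k t a b) \<partial>measure_pmf (vec_pmf k)) = ennreal (p_val k t ^ 2)"
proof -
  have "(\<integral>\<^sup>+a. ennreal (pair_prob k t a b) \<partial>measure_pmf (vec_pmf k)) =
      (\<integral>\<^sup>+a. \<integral>\<^sup>+z. of_bool (wt (vadd b z) = t) * of_bool (wt (vadd a z) = t)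
        \<partial>measure_pmf (vec_pmf k) \<partial>measure_pmf (vec_pmf k))"
    by (simp add: pair_prob_def conj_commute flip: nn_integral_of_bool of_bool_conj)
  also have "\<dots> = (\<integral>\<^sup>+z. of_bool (wt (vadd b z) = t) *
      (\<integral>\<^sup>+a. of_bool (wt (vadd a z) = t) \<partial>measure_pmf (vec_pmf k)) \<partial>measure_pmf (vec_pmf k))"
    by (subst nn_integral_pmf_swap) (simp add: nn_integral_cmult)
  also have "\<dots> = (\<integral>\<^sup>+z. of_bool (wt (vadd b z) = t) * ennreal (p_val k t) \<partial>measure_pmf (vec_pmf k))"
  proof (rule nn_integral_cong_pmf)
    fix z assume "z \<in> set_pmf (vec_pmf k)"
    then have z: "length z = k" by simp
    \<comment> \<open>By symmetry of the distance, the uniform vector \<open>a\<close> now plays the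
      part of the random centre around \<open>z\<close>.\<close>
    have "(\<integral>\<^sup>+a. of_bool (wt (vadd a z) = t) \<partial>measure_pmf (vec_pmf k)) =
        (\<integral>\<^sup>+a. of_bool (wt (vadd z a) = t) \<partial>measure_pmf (vec_pmf k))"
      by (rule nn_integral_cong_pmf) (simp add: z vadd_commute)
    also have "\<dots> = ennreal (p_val k t)" by (simp add: nn_integral_of_bool prob_wt_vadd z)
    finally show "of_bool (wt (vadd b z) = t) * (\<integral>\<^sup>+a. of_bool (wt (vadd a z) = t) \<partial>measure_pmf (vec_pmf k)) =
        of_bool (wt (vadd b z) = t) * ennreal (p_val k t)" by simp
  qed
  also have "\<dots> = ennreal (p_val k t ^ 2)"
    by (simp add: nn_integral_multc nn_integral_of_bool prob_wt_vadd assms power2_eq_square ennreal_mult')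
  finally show ?thesis .
qed

lemma block_Suc_drop: "block (Suc j) k v = block j k (drop k v)"
  by (simp add: block_def add.commute)

lemma length_block: "length v = m * k \<Longrightarrow> j < m \<Longrightarrow> length (block j k v) = k"
proof -
  assume "length v = m * k" "j < m"
  then have "Suc j * k \<le> length v" by (metis Suc_leI mult_le_mono1)
  then show ?thesis by (simp add: block_def)
qed

text \<open>The blocks of a uniform vector are independent, so splitting off the first block makes
  the expectation a product, one factor \<open>p_val k t ^ 2\<close> for each level.\<close>

lemma nn_integral_path_prob:
  "length b = m * k \<Longrightarrow>
    (\<integral>\<^sup>+a. ennreal (path_prob m k t 0 a b) \<partial>measure_pmf (vec_pmf (m * k))) = ennreal (p_val k t ^ (2 * m))"
proof (induction m arbitrary: b)
  case (Suc m)
  have "(\<integral>\<^sup>+a. ennreal (path_prob (Suc m) k t 0 a b) \<partial>measure_pmf (vec_pmf (Suc m * k))) =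
     (\<integral>\<^sup>+a0. \<integral>\<^sup>+a'. ennreal (path_prob (Suc m) k t 0 (a0 @ a') b)
        \<partial>measure_pmf (vec_pmf (m * k)) \<partial>measure_pmf (vec_pmf k))"
    by (simp add: vec_pmf_append)
  also have "\<dots> = (\<integral>\<^sup>+a0. \<integral>\<^sup>+a'. ennreal (pair_prob k t a0 (take k b)) * ennreal (path_prob m k t 0 a' (drop k b))
        \<partial>measure_pmf (vec_pmf (m * k)) \<partial>measure_pmf (vec_pmf k))"
  proof (intro nn_integral_cong_pmf)
    fix a0 a' :: "bool list" assume "a0 \<in> set_pmf (vec_pmf k)"
    then have "path_prob (Suc m) k t 0 (a0 @ a') b = pair_prob k t a0 (take k b) * path_prob m k t 0 a' (drop k b)"
      by (simp add: path_prob_Suc) (simp add: path_prob_def block_Suc_drop block_def[of 0])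
    then show "ennreal (path_prob (Suc m) k t 0 (a0 @ a') b) =
        ennreal (pair_prob k t a0 (take k b)) * ennreal (path_prob m k t 0 a' (drop k b))"
      by (simp add: ennreal_mult')
  qed
  also have "\<dots> = ennreal (p_val k t ^ 2) * ennreal (p_val k t ^ (2 * m))"
    using Suc.prems Suc.IH[of "drop k b"]
    by (simp add: nn_integral_cmult nn_integral_multc nn_integral_pair_prob)
  also have "\<dots> = ennreal (p_val k t ^ (2 * Suc m))"
    by (simp add: power2_eq_square ennreal_mult'[symmetric] power_add mult.assoc)
  finally show ?case .
qed (simp add: vec_pmf_def)

section \<open>Random lists under a coordinate permutation\<close>

definition permute_vec :: "nat \<Rightarrow> (nat \<Rightarrow> nat) \<Rightarrow> bool list \<Rightarrow> bool list" where
  "permute_vec d \<pi> v = map (\<lambda>j. v ! \<pi> j) [0..<d]"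

lemma length_permute_vec [simp]: "length (permute_vec d \<pi> v) = d"
  and nth_permute_vec [simp]: "j < d \<Longrightarrow> permute_vec d \<pi> v ! j = v ! \<pi> j"
  by (simp_all add: permute_vec_def)

lemma bij_betw_permute_vec:
  assumes "\<pi> permutes {..<d}"
  shows "bij_betw (permute_vec d \<pi>) {v. length v = d} {v. length v = d}"
proof (rule bij_betw_byWitness[where f' = "permute_vec d (inv \<pi>)"])
  have *: "\<sigma> j < d" if "\<sigma> permutes {..<d}" "j < d" for \<sigma> j
    using permutes_in_image[OF that(1), of j] that(2) by simp
  show "\<forall>v\<in>{v. length v = d}. permute_vec d (inv \<pi>) (permute_vec d \<pi> v) = v"
    "\<forall>v\<in>{v. length v = d}. permute_vec d \<pi> (permute_vec d (inv \<pi>) v) = v"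
    using assms *[OF assms] *[OF permutes_inv[OF assms]]
    by (auto intro!: nth_equalityI simp: permutes_inverses)
qed auto

text \<open>A fixed permutation maps the uniform distribution to itself, so it can be absorbed into
  \<open>a\<close>.\<close>

lemma nn_integral_permuted_path_prob:
  assumes "\<pi> permutes {..<r * k}" "length b = r * k"
  shows "(\<integral>\<^sup>+a. ennreal (path_prob r k t 0 (permute_vec (r * k) \<pi> a) b) \<partial>measure_pmf (vec_pmf (r * k)))
    = ennreal (p_val k t ^ (2 * r))"
proof -
  have "(\<integral>\<^sup>+a. ennreal (path_prob r k t 0 (permute_vec (r * k) \<pi> a) b) \<partial>measure_pmf (vec_pmf (r * k))) =
    (\<integral>\<^sup>+a. ennreal (path_prob r k t 0 a b) \<partial>measure_pmf (map_pmf (permute_vec (r * k) \<pi>) (vec_pmf (r * k))))"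
    by simp
  also have "\<dots> = ennreal (p_val k t ^ (2 * r))"
    unfolding map_vec_pmf_bij[OF bij_betw_permute_vec[OF assms(1)]]
    by (rule nn_integral_path_prob[OF assms(2)])
  finally show ?thesis .
qed

abbreviation lists_pmf :: "nat \<Rightarrow> nat \<Rightarrow> bool list list pmf" where
  "lists_pmf n d \<equiv> replicate_pmf n (vec_pmf d)"

lemma lists_pmf_length: "L \<in> set_pmf (lists_pmf n d) \<Longrightarrow> length L = n"
  by (simp add: set_replicate_pmf)

text \<open>At every index pair other than \<open>(i, j)\<close> at least one of the two entries is
  a fresh uniform vector, independent of the other. Integrating over that entry first gives
  \<open>p_val k t ^ (2 * r)\<close>: it lies in \<open>L1\<close> if \<open>u\<close> differs from
  \<open>i\<close>, and otherwise in \<open>L2\<close>.\<close>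

lemma nn_integral_planted_pairs:
  fixes k r t :: nat
  defines "d \<equiv> r * k"
  defines "G \<equiv> \<lambda>\<pi> a b. ennreal (path_prob r k t 0 (permute_vec d \<pi> a) (permute_vec d \<pi> b))"
  assumes \<pi>: "\<pi> permutes {..<d}" and xy: "length x = d" "length y = d" and ij: "i < n" "j < n"
  shows "(\<integral>\<^sup>+L1. \<integral>\<^sup>+L2. (\<Sum>a\<leftarrow>L1[i := x]. \<Sum>b\<leftarrow>L2[j := y]. G \<pi> a b) \<partial>measure_pmf (lists_pmf n d) \<partial>measure_pmf (lists_pmf n d))
    = G \<pi> x y + ennreal (real (n * n - 1) * p_val k t ^ (2 * r))"
proof -
  define T where "T = (\<lambda>(u, v). \<integral>\<^sup>+L1. \<integral>\<^sup>+L2. G \<pi> (L1[i := x] ! u) (L2[j := y] ! v)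
    \<partial>measure_pmf (lists_pmf n d) \<partial>measure_pmf (lists_pmf n d))"
  have "(\<integral>\<^sup>+L1. \<integral>\<^sup>+L2. (\<Sum>a\<leftarrow>L1[i := x]. \<Sum>b\<leftarrow>L2[j := y]. G \<pi> a b) \<partial>measure_pmf (lists_pmf n d) \<partial>measure_pmf (lists_pmf n d))
     = (\<integral>\<^sup>+L1. \<integral>\<^sup>+L2. (\<Sum>u<n. \<Sum>v<n. G \<pi> (L1[i := x] ! u) (L2[j := y] ! v))
        \<partial>measure_pmf (lists_pmf n d) \<partial>measure_pmf (lists_pmf n d))"
    by (intro nn_integral_cong_pmf) (simp add: sum_list_sum_nth lists_pmf_length atLeast0LessThan)
  also have "\<dots> = (\<Sum>u<n. \<Sum>v<n. T (u, v))"
    by (simp add: nn_integral_sum T_def)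
  also have "\<dots> = sum T ({..<n} \<times> {..<n})"
    by (simp add: sum.cartesian_product)
  also have "\<dots> = T (i, j) + sum T ({..<n} \<times> {..<n} - {(i, j)})"
    using ij by (intro sum.remove) auto
  also have "T (i, j) = G \<pi> x y"
  proof -
    have "T (i, j) = (\<integral>\<^sup>+L1. \<integral>\<^sup>+L2. G \<pi> x y \<partial>measure_pmf (lists_pmf n d) \<partial>measure_pmf (lists_pmf n d))"
      unfolding T_def split using ij by (intro nn_integral_cong_pmf) (simp add: lists_pmf_length)
    then show ?thesis by simp
  qed
  also have "sum T ({..<n} \<times> {..<n} - {(i, j)}) = (\<Sum>_\<in>{..<n} \<times> {..<n} - {(i, j)}. ennreal (p_val k t ^ (2 * r)))"
  proof (rule sum.cong[OF refl])
    fix z assume "z \<in> {..<n} \<times> {..<n} - {(i, j)}"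
    then obtain u v where uv: "u < n" "v < n" "\<not> (u = i \<and> v = j)" and z: "z = (u, v)"
      by auto
    show "T z = ennreal (p_val k t ^ (2 * r))"
    proof (cases "u = i")
      case False
      have "T z = (\<integral>\<^sup>+L2. \<integral>\<^sup>+L1. G \<pi> (L1 ! u) (L2[j := y] ! v) \<partial>measure_pmf (lists_pmf n d) \<partial>measure_pmf (lists_pmf n d))"
        unfolding z T_def split using False by (subst nn_integral_pmf_swap) simp
      also have "\<dots> = (\<integral>\<^sup>+L2. ennreal (p_val k t ^ (2 * r)) \<partial>measure_pmf (lists_pmf n d))"
      proof (rule nn_integral_cong_pmf)
        fix L2
        have "(\<integral>\<^sup>+L1. G \<pi> (L1 ! u) (L2[j := y] ! v) \<partial>measure_pmf (lists_pmf n d)) =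
            (\<integral>\<^sup>+a. G \<pi> a (L2[j := y] ! v) \<partial>measure_pmf (vec_pmf d))"
          by (rule nn_integral_replicate_pmf_nth[OF uv(1)])
        also have "\<dots> = ennreal (p_val k t ^ (2 * r))"
          using \<pi> unfolding G_def d_def by (rule nn_integral_permuted_path_prob) simp
        finally show "(\<integral>\<^sup>+L1. G \<pi> (L1 ! u) (L2[j := y] ! v) \<partial>measure_pmf (lists_pmf n d)) = \<dots>" .
      qed
      finally show ?thesis by simp
    next
      case True
      then have "T z = (\<integral>\<^sup>+L1. \<integral>\<^sup>+L2. G \<pi> x (L2 ! v) \<partial>measure_pmf (lists_pmf n d) \<partial>measure_pmf (lists_pmf n d))"
        unfolding z T_def split using uv by (intro nn_integral_cong_pmf) (auto simp: lists_pmf_length)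
      also have "\<dots> = (\<integral>\<^sup>+L1. ennreal (p_val k t ^ (2 * r)) \<partial>measure_pmf (lists_pmf n d))"
      proof (rule nn_integral_cong_pmf)
        fix L1 :: "bool list list"
        have "(\<integral>\<^sup>+L2. G \<pi> x (L2 ! v) \<partial>measure_pmf (lists_pmf n d)) = (\<integral>\<^sup>+b. G \<pi> x b \<partial>measure_pmf (vec_pmf d))"
          by (rule nn_integral_replicate_pmf_nth[OF uv(2)])
        also have "\<dots> = ennreal (p_val k t ^ (2 * r))"
          using \<pi> unfolding G_def d_def path_prob_commute[of r k t 0 "permute_vec _ _ x"]
          by (rule nn_integral_permuted_path_prob) simp
        finally show "(\<integral>\<^sup>+L2. G \<pi> x (L2 ! v) \<partial>measure_pmf (lists_pmf n d)) = \<dots>" .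
      qed
      finally show ?thesis by simp
    qed
  qed
  also have "\<dots> = ennreal (real (n * n - 1) * p_val k t ^ (2 * r))"
    using ij by (simp add: card_cartesian_product card_Diff_subset ennreal_mult' ennreal_of_nat_eq_real_of_nat
        del: of_nat_diff)
  finally show ?thesis .
qed

text \<open>The expected cost of a repetition apart from comparisons: nodes, scans of two lists of
  length \<open>n\<close>, and the application of the permutation.\<close>

definition fixed_cost :: "nat \<Rightarrow> nat \<Rightarrow> nat \<Rightarrow> nat \<Rightarrow> real \<Rightarrow> real" where
  "fixed_cost d r n N p = node_count N r + scan_count N p r * (2 * real n) + 2 * real n * real d"

lemma repetition_eq:
  "repetition d r k t N w L1 L2 = do {
     \<pi> \<leftarrow> pmf_of_set {\<pi>. \<pi> permutes {..<d}};
     x \<leftarrow> bucket_tree r d k t N w 0 (map (\<lambda>v. (v, permute_vec d \<pi> v)) L1) (map (\<lambda>v. (v, permute_vec d \<pi> v)) L2);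
     return_pmf (fst x, snd x + (length L1 + length L2) * d) }"
  by (simp add: repetition_def permute_vec_def case_prod_beta')

lemma finite_permutations_lessThan: "finite {\<pi>. \<pi> permutes {..<d :: nat}}"
  and permutations_lessThan_nonempty: "{\<pi>. \<pi> permutes {..<d :: nat}} \<noteq> {}"
  using finite_permutations[of "{..<d}"] permutes_id[of "{..<d}"] by (simp, blast)

lemma set_pmf_permutations [simp]:
  "set_pmf (pmf_of_set {\<pi>. \<pi> permutes {..<d :: nat}}) = {\<pi>. \<pi> permutes {..<d}}"
  by (rule set_pmf_of_set[OF permutations_lessThan_nonempty finite_permutations_lessThan])

lemma nn_integral_repetition_cost:
  fixes k r :: nat
  defines "d \<equiv> r * k"
  assumes "length L1 = n" "length L2 = n"
  shows "(\<integral>\<^sup>+x. of_nat (snd x) \<partial>measure_pmf (repetition d r k t N w L1 L2)) =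
    ennreal (fixed_cost d r n N (p_val k t)) + ennreal (real d * real N ^ r) *
    (\<integral>\<^sup>+\<pi>. (\<Sum>a\<leftarrow>L1. \<Sum>b\<leftarrow>L2. ennreal (path_prob r k t 0 (permute_vec d \<pi> a) (permute_vec d \<pi> b)))
      \<partial>measure_pmf (pmf_of_set {\<pi>. \<pi> permutes {..<d}}))"
    (is "_ = ?F + ?c * ?I")
proof -
  let ?M = "pmf_of_set {\<pi>. \<pi> permutes {..<d}}"
  let ?G = "\<lambda>\<pi>. \<Sum>a\<leftarrow>L1. \<Sum>b\<leftarrow>L2. ennreal (path_prob r k t 0 (permute_vec d \<pi> a) (permute_vec d \<pi> b))"
  let ?T = "\<lambda>\<pi>. bucket_tree r d k t N w 0 (map (\<lambda>v. (v, permute_vec d \<pi> v)) L1) (map (\<lambda>v. (v, permute_vec d \<pi> v)) L2)"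
  have tree: "(\<integral>\<^sup>+x. of_nat (snd x) \<partial>measure_pmf (?T \<pi>)) =
     ennreal (node_count N r) + ennreal (scan_count N (p_val k t) r) * (of_nat n + of_nat n) + ?c * ?G \<pi>" for \<pi>
    using assms by (subst nn_integral_bucket_tree_cost)
      (auto simp: comp_def length_block[of _ r] simp del: sum_list_ennreal)
  have "(\<integral>\<^sup>+x. of_nat (snd x) \<partial>measure_pmf (repetition d r k t N w L1 L2)) =
    (\<integral>\<^sup>+\<pi>. (\<integral>\<^sup>+x. of_nat (snd x) \<partial>measure_pmf (?T \<pi>)) + of_nat ((n + n) * d) \<partial>measure_pmf ?M)"
    using assms by (simp add: repetition_eq nn_integral_add)
  also have "\<dots> = ennreal (node_count N r) + ennreal (scan_count N (p_val k t) r) * (of_nat n + of_nat n)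
      + of_nat ((n + n) * d) + ?c * ?I"
    unfolding tree by (simp add: nn_integral_add nn_integral_cmult add_ac del: sum_list_ennreal)
  also have "ennreal (node_count N r) + ennreal (scan_count N (p_val k t) r) * (of_nat n + of_nat n)
      + of_nat ((n + n) * d) = ?F"
    by (simp add: fixed_cost_def node_count_nonneg scan_count_nonneg ennreal_of_nat_eq_real_of_nat
        ennreal_mult'[symmetric] ennreal_plus[symmetric] algebra_simps del: ennreal_plus)
  finally show ?thesis .
qed

section \<open>The planted instance\<close>

definition planted_pmf :: "nat \<Rightarrow> nat \<Rightarrow> nat \<Rightarrow> (bool list \<times> bool list \<times> nat \<times> nat) pmf" where
  "planted_pmf d n w = do {
     x \<leftarrow> vec_pmf d;
     y \<leftarrow> pmf_of_set {y. length y = d \<and> wt (vadd x y) = w};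
     i \<leftarrow> pmf_of_set {..<n};
     j \<leftarrow> pmf_of_set {..<n};
     return_pmf (x, y, i, j) }"

text \<open>The background lists are independent of the planted data, so the latter can be drawn
  first. Then \<open>x\<close>, \<open>y\<close>, \<open>i\<close>, \<open>j\<close> can be held
  fixed while averaging over the lists.\<close>

lemma cp_instance_eq:
  "cp_instance d n w = do {
     (x, y, i, j) \<leftarrow> planted_pmf d n w;
     L1 \<leftarrow> lists_pmf n d;
     L2 \<leftarrow> lists_pmf n d;
     return_pmf ((L1[i := x], L2[j := y]), (x, y)) }"
proof -
  have "cp_instance d n w = do {
     L1 \<leftarrow> lists_pmf n d;
     L2 \<leftarrow> lists_pmf n d;
     z \<leftarrow> planted_pmf d n w;
     return_pmf (case z of (x, y, i, j) \<Rightarrow> ((L1[i := x], L2[j := y]), (x, y))) }"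
    by (simp add: cp_instance_def planted_pmf_def bind_assoc_pmf bind_return_pmf)
  also have "\<dots> = do {
     L1 \<leftarrow> lists_pmf n d;
     z \<leftarrow> planted_pmf d n w;
     L2 \<leftarrow> lists_pmf n d;
     return_pmf (case z of (x, y, i, j) \<Rightarrow> ((L1[i := x], L2[j := y]), (x, y))) }"
    by (subst bind_commute_pmf[of "lists_pmf n d" "planted_pmf d n w"]) (rule refl)
  also have "\<dots> = do {
     z \<leftarrow> planted_pmf d n w;
     L1 \<leftarrow> lists_pmf n d;
     L2 \<leftarrow> lists_pmf n d;
     return_pmf (case z of (x, y, i, j) \<Rightarrow> ((L1[i := x], L2[j := y]), (x, y))) }"
    by (rule bind_commute_pmf)
  finally show ?thesis by (simp add: case_prod_beta')
qed

lemma weight_class_finite: "finite {y. length y = d \<and> wt (vadd x y) = w}"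
  by (rule finite_subset[OF _ finite_lists_length[of d]]) auto

text \<open>Flipping the first \<open>w\<close> coordinates of \<open>x\<close> gives an element.
  Nonemptiness is what makes \<open>pmf_of_set\<close> the uniform distribution on the
  class.\<close>

lemma weight_class_nonempty:
  assumes "length x = d" "w \<le> d"
  shows "{y. length y = d \<and> wt (vadd x y) = w} \<noteq> {}"
proof -
  have "wt (vadd x (vadd x (char_vec d {..<w}))) = card {..<w}"
    using wt_vadd_shift[of x d x "{..<w}"] assms by simp
  then have "vadd x (char_vec d {..<w}) \<in> {y. length y = d \<and> wt (vadd x y) = w}"
    using assms by simp
  then show ?thesis by blast
qed

lemma planted_pmfD:
  assumes "(x, y, i, j) \<in> set_pmf (planted_pmf d n w)" "w \<le> d" "0 < n"
  shows "length x = d" "length y = d" "wt (vadd x y) = w" "i < n" "j < n"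
  using assms weight_class_nonempty[of _ d w]
  by (auto simp: planted_pmf_def set_pmf_of_set[OF _ weight_class_finite] lessThan_empty_iff)

lemma nn_integral_planted_repetition_cost:
  fixes k r :: nat
  defines "d \<equiv> r * k"
  assumes xy: "length x = d" "length y = d" and ij: "i < n" "j < n"
  shows "(\<integral>\<^sup>+L1. \<integral>\<^sup>+L2. \<integral>\<^sup>+z. of_nat (snd z) \<partial>measure_pmf (repetition d r k t N w (L1[i := x]) (L2[j := y]))
      \<partial>measure_pmf (lists_pmf n d) \<partial>measure_pmf (lists_pmf n d)) =
    ennreal (fixed_cost d r n N (p_val k t)) + ennreal (real d * real N ^ r) *
    (\<integral>\<^sup>+\<pi>. ennreal (path_prob r k t 0 (permute_vec d \<pi> x) (permute_vec d \<pi> y)) +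
        ennreal (real (n * n - 1) * p_val k t ^ (2 * r)) \<partial>measure_pmf (pmf_of_set {\<pi>. \<pi> permutes {..<d}}))"
    (is "_ = ?F + ?c * (\<integral>\<^sup>+\<pi>. ?P \<pi> \<partial>measure_pmf ?M)")
proof -
  let ?L = "lists_pmf n d"
  let ?G = "\<lambda>L1 L2 \<pi>. \<Sum>a\<leftarrow>L1[i := x]. \<Sum>b\<leftarrow>L2[j := y].
    ennreal (path_prob r k t 0 (permute_vec d \<pi> a) (permute_vec d \<pi> b))"
  have "(\<integral>\<^sup>+L1. \<integral>\<^sup>+L2. \<integral>\<^sup>+z. of_nat (snd z) \<partial>measure_pmf (repetition d r k t N w (L1[i := x]) (L2[j := y]))
      \<partial>measure_pmf ?L \<partial>measure_pmf ?L) =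
    (\<integral>\<^sup>+L1. \<integral>\<^sup>+L2. ?F + ?c * (\<integral>\<^sup>+\<pi>. ?G L1 L2 \<pi> \<partial>measure_pmf ?M) \<partial>measure_pmf ?L \<partial>measure_pmf ?L)"
    unfolding d_def
    by (intro nn_integral_cong_pmf nn_integral_repetition_cost) (auto simp: lists_pmf_length)
  also have "\<dots> = ?F + ?c * (\<integral>\<^sup>+L1. \<integral>\<^sup>+L2. \<integral>\<^sup>+\<pi>. ?G L1 L2 \<pi> \<partial>measure_pmf ?M \<partial>measure_pmf ?L \<partial>measure_pmf ?L)"
    by (simp add: nn_integral_add nn_integral_cmult del: sum_list_ennreal)
  \<comment> \<open>The average over the lists is known for each fixed permutation, so the
    permutation is moved to the outermost integral.\<close>
  also have "(\<integral>\<^sup>+L1. \<integral>\<^sup>+L2. \<integral>\<^sup>+\<pi>. ?G L1 L2 \<pi> \<partial>measure_pmf ?M \<partial>measure_pmf ?L \<partial>measure_pmf ?L) =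
      (\<integral>\<^sup>+L1. \<integral>\<^sup>+\<pi>. \<integral>\<^sup>+L2. ?G L1 L2 \<pi> \<partial>measure_pmf ?L \<partial>measure_pmf ?M \<partial>measure_pmf ?L)"
    by (subst nn_integral_pmf_swap[where A = ?L and B = ?M]) (rule refl)
  also have "\<dots> = (\<integral>\<^sup>+\<pi>. \<integral>\<^sup>+L1. \<integral>\<^sup>+L2. ?G L1 L2 \<pi> \<partial>measure_pmf ?L \<partial>measure_pmf ?L \<partial>measure_pmf ?M)"
    by (rule nn_integral_pmf_swap)
  also have "\<dots> = (\<integral>\<^sup>+\<pi>. ?P \<pi> \<partial>measure_pmf ?M)"
    using xy ij unfolding d_def
    by (intro nn_integral_cong_pmf nn_integral_planted_pairs) auto
  finally show ?thesis .
qed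

lemma nn_integral_bucket_alg_cost:
  "(\<integral>\<^sup>+z. of_nat (snd z) \<partial>measure_pmf (bucket_alg d r k t N w P L1 L2)) =
    of_nat P * (\<integral>\<^sup>+z. of_nat (snd z) \<partial>measure_pmf (repetition d r k t N w L1 L2))"
  using nn_integral_replicate_pmf_sum_list[where f = "\<lambda>z. of_nat (snd z)"]
  by (simp add: bucket_alg_def of_nat_sum_list comp_def)

lemma nn_integral_cp_run_cost:
  fixes k r h t :: nat
  defines "d \<equiv> r * k"
  assumes "0 < r" "0 < n" "2 * h \<le> k"
  defines "N \<equiv> nat \<lceil>real d / q_val k t h\<rceil>"
  shows "(\<integral>\<^sup>+z. of_nat (snd z) \<partial>measure_pmf (cp_run d r h t n)) =
    ennreal (real ((d + 1) ^ (r + 1))) * (\<integral>\<^sup>+(x, y, _, _). ennreal (fixed_cost d r n N (p_val k t)) +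
      ennreal (real d * real N ^ r) *
      (\<integral>\<^sup>+\<pi>. ennreal (path_prob r k t 0 (permute_vec d \<pi> x) (permute_vec d \<pi> y)) +
        ennreal (real (n * n - 1) * p_val k t ^ (2 * r)) \<partial>measure_pmf (pmf_of_set {\<pi>. \<pi> permutes {..<d}}))
      \<partial>measure_pmf (planted_pmf d n (2 * r * h)))"
proof -
  let ?w = "2 * r * h" and ?P = "(d + 1) ^ (r + 1)"
  have w: "?w \<le> d" using assms by (simp add: d_def)
  have k: "d div r = k" using assms by (simp add: d_def)
  have "(\<integral>\<^sup>+z. of_nat (snd z) \<partial>measure_pmf (cp_run d r h t n)) =
    (\<integral>\<^sup>+(x, y, i, j). of_nat ?P * (\<integral>\<^sup>+L1. \<integral>\<^sup>+L2. \<integral>\<^sup>+z. of_nat (snd z)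
        \<partial>measure_pmf (repetition d r k t N ?w (L1[i := x]) (L2[j := y]))
      \<partial>measure_pmf (lists_pmf n d) \<partial>measure_pmf (lists_pmf n d)) \<partial>measure_pmf (planted_pmf d n ?w))"
    unfolding cp_run_def Let_def k N_def[symmetric]
    by (simp add: cp_instance_eq case_prod_beta' nn_integral_bucket_alg_cost nn_integral_cmult
        del: of_nat_power power_Suc of_nat_mult)
  also have "\<dots> = (\<integral>\<^sup>+(x, y, i, j). of_nat ?P * (ennreal (fixed_cost d r n N (p_val k t)) +
      ennreal (real d * real N ^ r) *
      (\<integral>\<^sup>+\<pi>. ennreal (path_prob r k t 0 (permute_vec d \<pi> x) (permute_vec d \<pi> y)) +
        ennreal (real (n * n - 1) * p_val k t ^ (2 * r)) \<partial>measure_pmf (pmf_of_set {\<pi>. \<pi> permutes {..<d}})))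
      \<partial>measure_pmf (planted_pmf d n ?w))"
  proof (rule nn_integral_cong_pmf, clarify)
    fix x y i j assume "(x, y, i, j) \<in> set_pmf (planted_pmf d n ?w)"
    then have "length x = r * k" "length y = r * k" "i < n" "j < n"
      using planted_pmfD[of x y i j d n ?w] w assms by auto
    note nn_integral_planted_repetition_cost[OF this, folded d_def]
    then show "of_nat ?P * (\<integral>\<^sup>+L1. \<integral>\<^sup>+L2. \<integral>\<^sup>+z. of_nat (snd z)
        \<partial>measure_pmf (repetition d r k t N ?w (L1[i := x]) (L2[j := y]))
      \<partial>measure_pmf (lists_pmf n d) \<partial>measure_pmf (lists_pmf n d)) =
      of_nat ?P * (ennreal (fixed_cost d r n N (p_val k t)) +
      ennreal (real d * real N ^ r) *
      (\<integral>\<^sup>+\<pi>. ennreal (path_prob r k t 0 (permute_vec d \<pi> x) (permute_vec d \<pi> y)) +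
        ennreal (real (n * n - 1) * p_val k t ^ (2 * r)) \<partial>measure_pmf (pmf_of_set {\<pi>. \<pi> permutes {..<d}})))"
      by (simp only:)
  qed
  finally show ?thesis
    by (simp add: case_prod_beta' nn_integral_cmult ennreal_of_nat_eq_real_of_nat
        del: of_nat_power power_Suc of_nat_mult)
qed

lemma fixed_cost_nonneg: "0 \<le> p \<Longrightarrow> 0 \<le> fixed_cost d r n N p"
  by (simp add: fixed_cost_def node_count_nonneg scan_count_nonneg)

text \<open>The only part of the cost formula that varies with the planted data is the path
  probability of the planted pair. Bounding it below by 0 and above by \<open>p ^ r\<close> gives
  the two estimates.\<close>

lemma expected_time_bounds:
  fixes k r h t :: nat
  defines "d \<equiv> r * k"
  assumes "0 < r" "0 < n" "2 * h \<le> k"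
  defines "N \<equiv> nat \<lceil>real d / q_val k t h\<rceil>" and "p \<equiv> p_val k t"
  shows "real (d + 1) ^ (r + 1) * (fixed_cost d r n N p + real d * real N ^ r * (real (n * n - 1) * p ^ (2 * r)))
      \<le> expected_time d r h t n" (is "?l \<le> _")
    and "expected_time d r h t n \<le> real (d + 1) ^ (r + 1) *
      (fixed_cost d r n N p + real d * real N ^ r * (p ^ r + real (n * n - 1) * p ^ (2 * r)))" (is "_ \<le> ?u")
proof -
  let ?E = "\<integral>\<^sup>+z. of_nat (snd z) \<partial>measure_pmf (cp_run d r h t n)"
  let ?F = "fixed_cost d r n N p" and ?c = "real d * real N ^ r" and ?m = "real (n * n - 1) * p ^ (2 * r)"
  let ?Q = "planted_pmf d n (2 * r * h)" and ?M = "pmf_of_set {\<pi>. \<pi> permutes {..<d}}"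
  have p: "0 \<le> p" by (simp add: p_def)
  have F: "0 \<le> ?F" using p by (rule fixed_cost_nonneg)
  have w: "2 * r * h \<le> d" using assms by (simp add: d_def)
  have E: "?E = ennreal (real ((d + 1) ^ (r + 1))) * (\<integral>\<^sup>+(x, y, _, _). ennreal ?F + ennreal ?c *
      (\<integral>\<^sup>+\<pi>. ennreal (path_prob r k t 0 (permute_vec d \<pi> x) (permute_vec d \<pi> y)) + ennreal ?m
        \<partial>measure_pmf ?M) \<partial>measure_pmf ?Q)"
    using nn_integral_cp_run_cost[OF assms(2-4), of t] unfolding d_def N_def p_def .
  have "ennreal ?l = ennreal (real ((d + 1) ^ (r + 1))) * (\<integral>\<^sup>+_. ennreal ?F + ennreal ?c * (\<integral>\<^sup>+_. ennreal ?m \<partial>measure_pmf ?M) \<partial>measure_pmf ?Q)"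
    using p F by (simp add: ennreal_mult' ennreal_plus[symmetric] ennreal_power del: ennreal_plus power_Suc of_nat_Suc)
       (simp add: ennreal_mult'[symmetric] ennreal_plus[symmetric] del: ennreal_plus power_Suc of_nat_Suc)
  also have "\<dots> \<le> ?E"
    unfolding E case_prod_beta'
    by (intro mult_left_mono nn_integral_mono add_left_mono) auto
  finally have l: "ennreal ?l \<le> ?E" .
  have "?E \<le> ennreal (real ((d + 1) ^ (r + 1))) * (\<integral>\<^sup>+_. ennreal ?F + ennreal ?c * (\<integral>\<^sup>+_. ennreal (p ^ r + ?m) \<partial>measure_pmf ?M) \<partial>measure_pmf ?Q)"
    unfolding E
  proof (intro mult_left_mono nn_integral_mono_AE, unfold AE_measure_pmf_iff, clarify)
    fix x y i j
    have "path_prob r k t 0 (permute_vec d \<pi> x) (permute_vec d \<pi> y) \<le> p ^ r" for \<pi>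
      unfolding p_def by (rule path_prob_le) (simp add: length_block[of _ r] d_def)
    then show "ennreal ?F + ennreal ?c * (\<integral>\<^sup>+\<pi>. ennreal (path_prob r k t 0 (permute_vec d \<pi> x) (permute_vec d \<pi> y)) + ennreal ?m
        \<partial>measure_pmf ?M) \<le> ennreal ?F + ennreal ?c * (\<integral>\<^sup>+_. ennreal (p ^ r + ?m) \<partial>measure_pmf ?M)"
      using p by (intro add_left_mono mult_left_mono nn_integral_mono)
        (auto simp: ennreal_plus[symmetric] simp del: ennreal_plus intro!: ennreal_leI)
  qed auto
  also have "\<dots> = ennreal ?u"
    using p F by (simp add: ennreal_mult'[symmetric] ennreal_plus[symmetric] del: ennreal_plus power_Suc of_nat_Suc)
  finally have u: "?E \<le> ennreal ?u" .
  have ET: "expected_time d r h t n = enn2real ?E"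
    unfolding expected_time_def by (subst integral_eq_nn_integral) (simp_all add: ennreal_of_nat_eq_real_of_nat)
  \<comment> \<open>\<open>enn2real\<close> sends infinity to 0, so the finiteness of
    \<open>?E\<close>, supplied by the upper bound, is needed to recover \<open>?E\<close> from the
    real expectation.\<close>
  have "?E < \<top>" using u by (rule order.strict_trans1) simp
  then have fin: "ennreal (expected_time d r h t n) = ?E"
    unfolding ET by simp
  have "0 \<le> expected_time d r h t n" unfolding ET by simp
  then show "?l \<le> expected_time d r h t n" using l unfolding fin[symmetric] by (simp add: ennreal_le_iff)
  have "0 \<le> ?u" using p F by simp
  then show "expected_time d r h t n \<le> ?u" using u unfolding fin[symmetric] by (simp add: ennreal_le_iff)
qed

subsection \<open>Success probability\<close>

text \<open>Bound the failure by \<open>f\<close> on \<open>G\<close> and by 1 elsewhere. The result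
  decreases in the probability of \<open>G\<close> because \<open>f \<le> 1\<close>, so a lower
  bound \<open>g\<close> for it suffices.\<close>

lemma prob_bind_pmf_le:
  assumes "\<And>z. z \<in> set_pmf M \<Longrightarrow> G z \<Longrightarrow> measure_pmf.prob (T z) F \<le> f" "0 \<le> f" "f \<le> 1"
    and "g \<le> measure_pmf.prob M {z. G z}"
  shows "measure_pmf.prob (bind_pmf M T) F \<le> 1 - g * (1 - f)"
proof -
  let ?p = "measure_pmf.prob M {z. G z}"
  have neg: "measure_pmf.prob M {z. \<not> G z} = 1 - ?p"
    using measure_pmf.prob_compl[of "{z. G z}" M] by (simp add: Compl_eq_Diff_UNIV[symmetric] Collect_neg_eq)
  have "emeasure (measure_pmf (bind_pmf M T)) F = (\<integral>\<^sup>+z. emeasure (measure_pmf (T z)) F \<partial>measure_pmf M)"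
    by simp
  also have "\<dots> \<le> (\<integral>\<^sup>+z. ennreal f * of_bool (G z) + of_bool (\<not> G z) \<partial>measure_pmf M)"
    using assms(1,2) by (intro nn_integral_mono_AE)
      (auto simp: AE_measure_pmf_iff measure_pmf.emeasure_eq_measure intro!: ennreal_leI)
  also have "\<dots> = ennreal (f * ?p + (1 - ?p))"
    using assms(2) by (simp add: nn_integral_add nn_integral_cmult nn_integral_of_bool neg
        ennreal_mult' ennreal_plus)
  finally have "measure_pmf.prob (bind_pmf M T) F \<le> f * ?p + (1 - ?p)"
    using assms(2) by (subst (asm) measure_pmf.emeasure_eq_measure) (simp add: ennreal_le_iff del: ennreal_plus)
  also have "\<dots> = 1 - ?p * (1 - f)" by (simp add: algebra_simps)
  also have "\<dots> \<le> 1 - g * (1 - f)" using assms(3,4) by (simp add: mult_right_mono)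
  finally show ?thesis .
qed

lemma prob_replicate_pmf_all:
  "measure_pmf.prob (replicate_pmf N p) {xs. \<forall>x\<in>set xs. Q x} = measure_pmf.prob p {x. Q x} ^ N"
  using emeasure_replicate_pmf_all[of N p Q]
  by (simp add: measure_pmf.emeasure_eq_measure ennreal_power)

text \<open>The union misses \<open>x\<close> iff each of the independent runs does. This serves
  both the children of a node and the repetitions of the algorithm.\<close>

lemma prob_replicate_pmf_Union:
  "measure_pmf.prob (replicate_pmf N M \<bind> (\<lambda>cs. return_pmf (\<Union> (set (map fst cs)), c cs))) {z. x \<notin> fst z}
    = measure_pmf.prob M {z. x \<notin> fst z} ^ N"
proof -
  have "replicate_pmf N M \<bind> (\<lambda>cs. return_pmf (\<Union> (set (map fst cs)), c cs)) =
      map_pmf (\<lambda>cs. (\<Union> (set (map fst cs)), c cs)) (replicate_pmf N M)"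
    by (simp add: map_pmf_def)
  then show ?thesis
    by (simp add: vimage_def flip: prob_replicate_pmf_all)
qed

text \<open>The left-hand side is convex in \<open>f\<close>; the right-hand side is its chord between \<open>f = 0\<close> and \<open>f = 1\<close>.\<close>

lemma power_mixture_le:
  fixes q f :: real
  assumes "0 \<le> q" "q \<le> 1" "0 \<le> f" "f \<le> 1"
  shows "(1 - q * (1 - f)) ^ N \<le> (1 - f) * (1 - q) ^ N + f"
proof (induction N)
  case (Suc N)
  let ?a = "(1 - q) ^ N"
  have a: "0 \<le> ?a" "?a \<le> 1" using assms by (auto intro: power_le_one)
  have "q * (1 - f) \<le> 1 * 1" using assms by (intro mult_mono) auto
  then have "(1 - q * (1 - f)) ^ Suc N \<le> (1 - q * (1 - f)) * ((1 - f) * ?a + f)"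
    using Suc by (simp add: mult_left_mono)
  also have "\<dots> = (1 - f) * (1 - q) ^ Suc N + f - q * f * (1 - f) * (1 - ?a)"
    by (simp add: algebra_simps)
  also have "\<dots> \<le> (1 - f) * (1 - q) ^ Suc N + f"
    using assms a by simp
  finally show ?case .
qed simp

text \<open>A node fails iff all its \<open>N\<close> children fail, and a child fails with
  probability at most \<open>1 - q * (1 - f)\<close>, where \<open>f\<close> bounds the failure one
  level below. The chord bound for the \<open>N\<close>-th power adds only \<open>e\<close> per
  level.\<close>

lemma prob_bucket_tree_fail:
  assumes "wt (vadd x' y') = w" "0 \<le> q" "q \<le> 1" "(1 - q) ^ N \<le> e"
  shows "(x, x') \<in> set A \<Longrightarrow> (y, y') \<in> set B \<Longrightarrow>
    (\<And>j. j < m \<Longrightarrow> q \<le> pair_prob k t (block (i + j) k x') (block (i + j) k y')) \<Longrightarrow>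
    measure_pmf.prob (bucket_tree m d k t N w i A B) {z. (x, y) \<notin> fst z} \<le> real m * e"
proof (induction m arbitrary: i A B)
  case 0
  have "(x, y) \<in> {(fst a, fst b) | a b. a \<in> set A \<and> b \<in> set B \<and> wt (vadd (snd a) (snd b)) = w}"
    using 0 assms(1) by force
  then show ?case by (simp add: measure_return_pmf)
next
  case (Suc m)
  have e: "0 \<le> e" using assms(3,4) by (meson diff_ge_0_iff_ge order_trans zero_le_power)
  define f where "f = real m * e"
  have f0: "0 \<le> f" using e by (simp add: f_def)
  let ?T = "\<lambda>z. bucket_tree m d k t N w (Suc i)
               (filter (\<lambda>a. wt (vadd (block i k (snd a)) z) = t) A)
               (filter (\<lambda>b. wt (vadd (block i k (snd b)) z) = t) B)"
  let ?F = "{z. (x, y) \<notin> fst z}"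
  have eq: "measure_pmf.prob (bucket_tree (Suc m) d k t N w i A B) ?F =
      measure_pmf.prob (vec_pmf k \<bind> ?T) ?F ^ N"
    by (simp only: bucket_tree.simps prob_replicate_pmf_Union)
  \<comment> \<open>The chord bound requires \<open>f \<le> 1\<close>. If \<open>f\<close> is
    larger, the claimed bound exceeds 1 and holds trivially.\<close>
  show ?case
  proof (cases "f \<le> 1")
    case True
    let ?G = "\<lambda>z. wt (vadd (block i k x') z) = t \<and> wt (vadd (block i k y') z) = t"
    have "measure_pmf.prob (vec_pmf k \<bind> ?T) ?F \<le> 1 - q * (1 - f)"
    proof (rule prob_bind_pmf_le[where G = ?G])
      fix z assume "?G z"
      then show "measure_pmf.prob (?T z) ?F \<le> f"
        unfolding f_def using Suc.prems(3)[of "Suc _"] by (intro Suc.IH) (auto simp: Suc.prems)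
    next
      show "q \<le> measure_pmf.prob (vec_pmf k) {z. ?G z}"
        using Suc.prems(3)[of 0] by (simp add: pair_prob_def)
    qed (use f0 True in auto)
    then have "measure_pmf.prob (vec_pmf k \<bind> ?T) ?F ^ N \<le> (1 - q * (1 - f)) ^ N"
      by (intro power_mono) auto
    also have "\<dots> \<le> (1 - f) * (1 - q) ^ N + f"
      using assms f0 True by (intro power_mixture_le) auto
    also have "\<dots> \<le> 1 * e + f"
      using assms f0 True e by (intro add_right_mono mult_mono) auto
    finally show ?thesis unfolding eq by (simp add: f_def distrib_right)
  next
    case False
    then have "1 \<le> real (Suc m) * e" using e by (simp add: f_def algebra_simps)
    then show ?thesis using measure_pmf.prob_le_1 order_trans by blast
  qed
qed

text \<open>The term \<open>j\<close> of the expansion of \<open>(m + (k - m))\<^sup>k\<close> is \<open>k\<^sup>k\<close> times the probability of \<open>j\<close>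
  under the binomial distribution with \<open>k\<close> trials and mean \<open>m\<close>; its mode is \<open>m\<close>.\<close>

lemma sum_binomial_weights: "(\<Sum>j\<le>k. (k choose j) * a ^ j * b ^ (k - j)) = (a + b :: nat) ^ k"
  by (simp add: binomial)

text \<open>After cancelling common factors the claim is
  \<open>Suc j * (k - m) \<le> (k - j) * m\<close>, which rearranges to
  \<open>Suc j * k \<le> m * (k + 1)\<close> and follows from \<open>j < m\<close>.\<close>

lemma binomial_mode_step:
  assumes "j < m" "m \<le> k"
  shows "(k choose j) * m ^ j * (k - m) ^ (k - j) \<le> (k choose Suc j) * m ^ Suc j * (k - m) ^ (k - Suc j)"
proof -
  have *: "Suc j * (k choose Suc j) = (k - j) * (k choose j)"
    using binomial_absorb_comp[of k j] binomial_absorption[of j k] by (metis mult.commute)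
  have "Suc j * (k - m) \<le> (k - j) * m"
  proof -
    have "int (Suc j) * int (k - m) \<le> int (k - j) * int m"
    proof -
      have "int (Suc j) * int k \<le> int m * (int k + 1)" using assms by (intro mult_mono) auto
      then show ?thesis using assms by (simp add: of_nat_diff algebra_simps)
    qed
    then have "int (Suc j * (k - m)) \<le> int ((k - j) * m)" by (simp only: of_nat_mult)
    then show ?thesis by (simp only: of_nat_le_iff)
  qed
  then have "Suc j * ((k choose j) * (k - m)) \<le> (k - j) * (k choose j) * m"
    by (metis mult.assoc mult.commute mult_le_mono2)
  also have "\<dots> = Suc j * ((k choose Suc j) * m)"
    using * by (simp add: mult.assoc[symmetric])
  finally have "(k choose j) * (k - m) \<le> (k choose Suc j) * m" by (simp only: Suc_mult_le_cancel1)
  then have "(k choose j) * (k - m) * (m ^ j * (k - m) ^ (k - Suc j)) \<le>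
      (k choose Suc j) * m * (m ^ j * (k - m) ^ (k - Suc j))"
    by (rule mult_le_mono1)
  moreover have "(k - m) ^ (k - j) = (k - m) * (k - m) ^ (k - Suc j)"
    using assms by (metis Suc_diff_Suc order_less_le_trans power_Suc)
  ultimately show ?thesis by (simp add: mult_ac)
qed

text \<open>The terms increase up to \<open>m\<close>. Beyond \<open>m\<close>, the symmetry that
  replaces \<open>j\<close> and \<open>m\<close> by \<open>k - j\<close> and \<open>k - m\<close>
  reduces to that case.\<close>

lemma binomial_mode:
  assumes "m \<le> k" "j \<le> k"
  shows "(k choose j) * m ^ j * (k - m) ^ (k - j) \<le> (k choose m) * m ^ m * (k - m) ^ (k - m)"
proof -
  have below: "(k choose j) * m ^ j * (k - m) ^ (k - j) \<le> (k choose m) * m ^ m * (k - m) ^ (k - m)"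
    if "j \<le> m" "m \<le> k" for j m
    using that(1)
  proof (induction rule: inc_induct)
    case (step j)
    then show ?case using binomial_mode_step[of j m k] that(2) by linarith
  qed simp
  show ?thesis
  proof (cases "j \<le> m")
    case False
    then show ?thesis
      using below[of "k - j" "k - m"] assms
      by (simp add: binomial_symmetric[of j k] binomial_symmetric[of m k] mult_ac)
  qed (use below assms in auto)
qed

text \<open>The \<open>k + 1\<close> terms sum to \<open>k ^ k\<close>, so the largest is at least
  their average.\<close>

lemma power_le_binomial_mode:
  assumes "m \<le> k"
  shows "k ^ k \<le> Suc k * ((k choose m) * m ^ m * (k - m) ^ (k - m))"
proof -
  have "k ^ k = (\<Sum>j\<le>k. (k choose j) * m ^ j * (k - m) ^ (k - j))"
    using assms by (simp add: sum_binomial_weights)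
  also have "\<dots> \<le> (\<Sum>j\<le>k. (k choose m) * m ^ m * (k - m) ^ (k - m))"
    using assms by (intro sum_mono binomial_mode) auto
  finally show ?thesis by simp
qed

text \<open>Use the same weights \<open>m\<close> and \<open>k - m\<close> at both scales: one term
  of the expansion of \<open>k ^ (r * k)\<close> is at most the whole, which is the
  \<open>r\<close>-th power of \<open>k ^ k\<close>. The weight factors then cancel.\<close>

lemma binomial_mult_le:
  assumes "m \<le> k"
  shows "(r * k) choose (r * m) \<le> (Suc k * (k choose m)) ^ r"
proof -
  let ?c = "m ^ m * (k - m) ^ (k - m)"
  \<comment> \<open>This includes \<open>m = 0\<close> and \<open>m = k\<close>, where
    \<open>0 ^ 0 = 1\<close>.\<close>
  have pos: "0 < ?c" using assms by (auto simp: order_le_less)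
  have "((r * k) choose (r * m)) * ?c ^ r = ((r * k) choose (r * m)) * m ^ (r * m) * (k - m) ^ (r * k - r * m)"
    by (simp add: power_mult_distrib power_mult[symmetric] mult.commute diff_mult_distrib2 mult.left_commute)
  also have "\<dots> \<le> (\<Sum>j\<le>r * k. ((r * k) choose j) * m ^ j * (k - m) ^ (r * k - j))"
    using assms by (intro member_le_sum[of "r * m"]) auto
  also have "\<dots> = (m + (k - m)) ^ (r * k)"
    by (rule sum_binomial_weights)
  also have "\<dots> = (k ^ k) ^ r"
    using assms by (simp add: power_mult[symmetric] mult.commute)
  also have "\<dots> \<le> (Suc k * ((k choose m) * m ^ m * (k - m) ^ (k - m))) ^ r"
    by (intro power_mono power_le_binomial_mode assms) auto
  also have "\<dots> = (Suc k * (k choose m)) ^ r * ?c ^ r"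
    by (simp only: power_mult_distrib[symmetric] mult.assoc)
  finally show ?thesis using pos by simp
qed

section \<open>Random permutations and balanced difference sets\<close>

lemma card_permutes_preimage_le:
  assumes "finite U" "S \<subseteq> U" "S' \<subseteq> U" "card S = card S'"
  shows "card {\<pi>. \<pi> permutes U \<and> {i \<in> U. \<pi> i \<in> D} = S'} \<le> card {\<pi>. \<pi> permutes U \<and> {i \<in> U. \<pi> i \<in> D} = S}"
proof -
  have fin: "finite S" "finite S'" using assms finite_subset by auto
  obtain f where f: "bij_betw f S S'"
    using finite_same_card_bij[OF fin assms(4)] by blast
  have "card (U - S) = card (U - S')"
    using assms fin by (simp add: card_Diff_subset)
  then obtain g where g: "bij_betw g (U - S) (U - S')"
    using finite_same_card_bij[of "U - S" "U - S'"] assms(1) by auto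
  \<comment> \<open>\<open>\<sigma>\<close> carries \<open>S\<close> to \<open>S'\<close> and the
    complement to the complement. Precomposing with it injects the permutations with preimage
    \<open>S'\<close> into those with preimage \<open>S\<close>.\<close>
  define \<sigma> where "\<sigma> i = (if i \<in> S then f i else if i \<in> U then g i else i)" for i
  have "bij_betw \<sigma> S S'"
    using f by (subst bij_betw_cong[where g = f]) (auto simp: \<sigma>_def)
  moreover have "bij_betw \<sigma> (U - S) (U - S')"
    using g by (subst bij_betw_cong[where g = g]) (auto simp: \<sigma>_def)
  ultimately have "bij_betw \<sigma> (S \<union> (U - S)) (S' \<union> (U - S'))"
    by (rule bij_betw_combine) auto
  then have \<sigma>: "\<sigma> permutes U"
    using assms by (intro bij_imp_permutes) (auto simp: \<sigma>_def Un_absorb1)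
  have \<sigma>_iff: "\<sigma> i \<in> U \<and> (\<sigma> i \<in> S' \<longleftrightarrow> i \<in> S)" if "i \<in> U" for i
    using that f g assms(2,3) by (auto simp: \<sigma>_def bij_betw_def)
  show ?thesis
  proof (rule card_inj_on_le[where f = "\<lambda>\<pi>. \<pi> \<circ> \<sigma>"])
    show "inj_on (\<lambda>\<pi>. \<pi> \<circ> \<sigma>) {\<pi>. \<pi> permutes U \<and> {i \<in> U. \<pi> i \<in> D} = S'}"
      using permutes_surj[OF \<sigma>] by (auto intro!: inj_onI simp: fun_eq_iff) (metis surjD)
    show "(\<lambda>\<pi>. \<pi> \<circ> \<sigma>) ` {\<pi>. \<pi> permutes U \<and> {i \<in> U. \<pi> i \<in> D} = S'} \<subseteq>
        {\<pi>. \<pi> permutes U \<and> {i \<in> U. \<pi> i \<in> D} = S}"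
    proof clarify
      fix \<pi> assume \<pi>: "\<pi> permutes U" and S': "S' = {i \<in> U. \<pi> i \<in> D}"
      have "(\<pi> \<circ> \<sigma>) i \<in> D \<longleftrightarrow> i \<in> S" if "i \<in> U" for i
        using \<sigma>_iff[OF that] by (auto simp: S')
      then have "{i \<in> U. (\<pi> \<circ> \<sigma>) i \<in> D} = S" using assms(2) by blast
      then show "\<pi> \<circ> \<sigma> permutes U \<and> {i \<in> U. (\<pi> \<circ> \<sigma>) i \<in> D} = S"
        using permutes_compose[OF \<sigma> \<pi>] by blast
    qed
    show "finite {\<pi>. \<pi> permutes U \<and> {i \<in> U. \<pi> i \<in> D} = S}"
      using finite_permutations[OF assms(1)] by (rule finite_subset[rotated]) auto
  qed
qed

text \<open>The preimage of \<open>D\<close> is uniform among the sets of size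
  \<open>card D\<close>: the preceding inequality, used in both directions, shows that all fibres
  have equal size.\<close>

lemma prob_permutation_preimage:
  assumes "D \<subseteq> {..<d}" "X \<subseteq> {S. S \<subseteq> {..<d} \<and> card S = card D}"
  shows "measure_pmf.prob (pmf_of_set {\<pi>. \<pi> permutes {..<d}}) {\<pi>. {i \<in> {..<d}. \<pi> i \<in> D} \<in> X}
    = real (card X) / real (d choose card D)"
proof -
  let ?W = "{S. S \<subseteq> {..<d} \<and> card S = card D}"
  let ?C = "\<lambda>S. {\<pi>. \<pi> permutes {..<d} \<and> {i \<in> {..<d}. \<pi> i \<in> D} = S}"
  have finW: "finite ?W" by (rule finite_subset[of _ "Pow {..<d}"]) auto
  have finC: "finite (?C S)" for S
    using finite_permutations_lessThan by (rule finite_subset[rotated]) auto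
  have count: "card {\<pi>. \<pi> permutes {..<d} \<and> {i \<in> {..<d}. \<pi> i \<in> D} \<in> Y} = card Y * card (?C D)" if "Y \<subseteq> ?W" for Y
  proof -
    have "{\<pi>. \<pi> permutes {..<d} \<and> {i \<in> {..<d}. \<pi> i \<in> D} \<in> Y} = (\<Union>S\<in>Y. ?C S)" by auto
    also have "card \<dots> = (\<Sum>S\<in>Y. card (?C S))"
      using finite_subset[OF that finW] finC by (intro card_UN_disjoint) auto
    also have "\<dots> = (\<Sum>S\<in>Y. card (?C D))"
      using that assms(1) by (intro sum.cong refl antisym card_permutes_preimage_le) auto
    finally show ?thesis by simp
  qed
  have "{i \<in> {..<d}. \<pi> i \<in> D} \<in> ?W" if "\<pi> permutes {..<d}" for \<pi>
  proof -
    have "\<pi> ` {i \<in> {..<d}. \<pi> i \<in> D} = D"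
    proof (intro equalityI subsetI)
      fix y assume "y \<in> D"
      moreover from this have "y \<in> \<pi> ` {..<d}"
        unfolding permutes_image[OF that] using assms(1) by (rule subsetD[rotated])
      ultimately show "y \<in> \<pi> ` {i \<in> {..<d}. \<pi> i \<in> D}" by blast
    qed blast
    moreover have "inj_on \<pi> {i \<in> {..<d}. \<pi> i \<in> D}"
      by (rule permutes_inj_on[OF that])
    ultimately have "card {i \<in> {..<d}. \<pi> i \<in> D} = card D"
      using card_image by metis
    then show ?thesis by blast
  qed
  then have all: "{\<pi>. \<pi> permutes {..<d}} = {\<pi>. \<pi> permutes {..<d} \<and> {i \<in> {..<d}. \<pi> i \<in> D} \<in> ?W}"
    by auto
  have cW: "card ?W = d choose card D" by (simp add: n_subsets)
  have all_card: "card {\<pi>. \<pi> permutes {..<d}} = (d choose card D) * card (?C D)"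
    using count[OF order_refl] by (simp only: all[symmetric] cW)
  have "card {\<pi>. \<pi> permutes {..<d}} \<noteq> 0"
    using finite_permutations_lessThan permutations_lessThan_nonempty by (simp only: card_eq_0_iff) simp
  then have "card (?C D) \<noteq> 0" unfolding all_card by simp
  have "measure_pmf.prob (pmf_of_set {\<pi>. \<pi> permutes {..<d}}) {\<pi>. {i \<in> {..<d}. \<pi> i \<in> D} \<in> X} =
    real (card {\<pi>. \<pi> permutes {..<d} \<and> {i \<in> {..<d}. \<pi> i \<in> D} \<in> X}) / real (card {\<pi>. \<pi> permutes {..<d}})"
    by (subst measure_pmf_of_set[OF permutations_lessThan_nonempty finite_permutations_lessThan])
      (simp add: Int_def)
  also have "\<dots> = real (card X) / real (d choose card D)"
    unfolding count[OF assms(2)] all_card using \<open>card (?C D) \<noteq> 0\<close> by simp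
  finally show ?thesis .
qed

definition balanced_sets :: "nat \<Rightarrow> nat \<Rightarrow> nat \<Rightarrow> nat set set" where
  "balanced_sets r k m = {S. S \<subseteq> {..<r * k} \<and> card S = r * m \<and> (\<forall>j<r. card (S \<inter> {j * k..<j * k + k}) = m)}"

lemma block_index_unique:
  fixes i j j' k :: nat
  assumes "i \<in> {j * k..<j * k + k}" "i \<in> {j' * k..<j' * k + k}"
  shows "j = j'"
proof -
  have "i div k = l" if "i \<in> {l * k..<l * k + k}" for l
    using that by (intro div_nat_eqI) (auto simp: mult.commute add.commute)
  then show ?thesis using assms by blast
qed

text \<open>Choose \<open>m\<close> points in each block separately. Since the blocks are disjoint,
  each choice can be read off from the union.\<close>

lemma card_balanced_sets_ge: "(k choose m) ^ r \<le> card (balanced_sets r k m)"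
proof -
  let ?B = "\<lambda>j. {j * k..<j * k + k}"
  let ?P = "\<Pi>\<^sub>E j\<in>{..<r}. {T. T \<subseteq> ?B j \<and> card T = m}"
  let ?f = "\<lambda>T. \<Union>j<r. T j"
  have inter: "?f T \<inter> ?B j = T j" if "T \<in> ?P" "j < r" for T j
  proof (intro set_eqI iffI)
    fix i assume "i \<in> ?f T \<inter> ?B j"
    then obtain j' where j': "j' < r" "i \<in> T j'" "i \<in> ?B j" by auto
    have "T j' \<subseteq> ?B j'" using that(1) j'(1) unfolding PiE_iff by blast
    then have "i \<in> ?B j'" using j'(2) by blast
    then have "j' = j" using j'(3) by (rule block_index_unique)
    then show "i \<in> T j" using j' by simp
  next
    fix i assume "i \<in> T j"
    moreover have "T j \<subseteq> ?B j" using that unfolding PiE_iff by blast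
    ultimately show "i \<in> ?f T \<inter> ?B j" using that(2) by blast
  qed
  have "(k choose m) ^ r = card ?P"
    by (simp add: card_PiE n_subsets)
  also have "\<dots> \<le> card (balanced_sets r k m)"
  proof (rule card_inj_on_le[where f = ?f])
    show "inj_on ?f ?P"
    proof (rule inj_onI)
      fix T T' assume T: "T \<in> ?P" "T' \<in> ?P" "?f T = ?f T'"
      show "T = T'"
      proof (rule PiE_ext[OF T(1,2)])
        fix j assume "j \<in> {..<r}"
        then have j: "j < r" by simp
        show "T j = T' j"
          unfolding inter[OF T(1) j, symmetric] inter[OF T(2) j, symmetric] by (simp only: T(3))
      qed
    qed
    show "?f ` ?P \<subseteq> balanced_sets r k m"
    proof (rule image_subsetI)
      fix T assume T: "T \<in> ?P"
      have Tj: "T j \<subseteq> ?B j" "card (T j) = m" if "j < r" for j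
        using T that unfolding PiE_iff by blast+
      have sub: "T j \<subseteq> {..<r * k}" if "j < r" for j
      proof -
        have "j * k + k \<le> r * k" using that by (metis Suc_leI add.commute mult_Suc mult_le_mono1)
        then have "?B j \<subseteq> {..<r * k}" by auto
        then show ?thesis using Tj(1)[OF that] by blast
      qed
      have "card (?f T) = (\<Sum>j<r. card (T j))"
      proof (rule card_UN_disjoint)
        show "\<forall>j\<in>{..<r}. finite (T j)" using sub finite_subset by blast
        show "\<forall>j\<in>{..<r}. \<forall>j'\<in>{..<r}. j \<noteq> j' \<longrightarrow> T j \<inter> T j' = {}"
        proof (intro ballI impI equals0I)
          fix j j' i assume *: "j \<in> {..<r}" "j' \<in> {..<r}" "j \<noteq> j'" "i \<in> T j \<inter> T j'"
          then have "i \<in> ?B j" "i \<in> ?B j'" using Tj(1) by blast+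
          then show False using block_index_unique *(3) by blast
        qed
      qed simp
      also have "\<dots> = r * m" using Tj(2) by simp
      finally have "card (?f T) = r * m" .
      moreover have "?f T \<subseteq> {..<r * k}" using sub by blast
      moreover have "card (?f T \<inter> ?B j) = m" if "j < r" for j
        using inter[OF T that] Tj(2)[OF that] by simp
      ultimately show "?f T \<in> balanced_sets r k m"
        unfolding balanced_sets_def by blast
    qed
    show "finite (balanced_sets r k m)"
      by (rule finite_subset[of _ "Pow {..<r * k}"]) (auto simp: balanced_sets_def)
  qed
  finally show ?thesis .
qed

lemma prob_balanced_permutation:
  assumes "D \<subseteq> {..<r * k}" "card D = r * m" "m \<le> k"
  shows "1 / real (Suc k) ^ r \<le> measure_pmf.prob (pmf_of_set {\<pi>. \<pi> permutes {..<r * k}})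
    {\<pi>. {i \<in> {..<r * k}. \<pi> i \<in> D} \<in> balanced_sets r k m}"
proof -
  have "real ((r * k) choose (r * m)) \<le> real ((Suc k * (k choose m)) ^ r)"
    using binomial_mult_le[OF assms(3), of r] by (rule of_nat_mono)
  also have "\<dots> = real (Suc k) ^ r * real (k choose m) ^ r"
    by (simp only: of_nat_power of_nat_mult power_mult_distrib)
  also have "\<dots> \<le> real (Suc k) ^ r * real (card (balanced_sets r k m))"
    using card_balanced_sets_ge[of k m r] by (intro mult_left_mono) (simp_all flip: of_nat_power)
  finally have "1 / real (Suc k) ^ r \<le> real (card (balanced_sets r k m)) / real ((r * k) choose (r * m))"
    using assms(3) by (simp add: field_simps del: of_nat_Suc)
  also have "\<dots> = measure_pmf.prob (pmf_of_set {\<pi>. \<pi> permutes {..<r * k}})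
    {\<pi>. {i \<in> {..<r * k}. \<pi> i \<in> D} \<in> balanced_sets r k m}"
    using assms by (subst prob_permutation_preimage) (auto simp: balanced_sets_def)
  finally show ?thesis .
qed

lemma wt_vadd_block:
  assumes "length a = r * k" "length b = r * k" "j < r"
  shows "wt (vadd (block j k a) (block j k b)) = card ({i \<in> {..<r * k}. a ! i \<noteq> b ! i} \<inter> {j * k..<j * k + k})"
proof -
  have le: "j * k + k \<le> r * k" using assms by (metis Suc_leI add.commute mult_Suc mult_le_mono1)
  have nth: "block j k v ! l = v ! (j * k + l)" if "length v = r * k" "l < k" for v :: "bool list" and l
  proof -
    have "j * k \<le> r * k" using le by linarith
    then show ?thesis using that by (simp add: block_def)
  qed
  have "wt (vadd (block j k a) (block j k b)) = card {l. l < k \<and> a ! (j * k + l) \<noteq> b ! (j * k + l)}"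
    unfolding wt_conv_card
    by (intro arg_cong[where f = card] Collect_cong)
      (simp add: nth length_block[OF _ assms(3)] assms(1,2) cong: conj_cong)
  also have "\<dots> = card ((\<lambda>l. j * k + l) ` {l. l < k \<and> a ! (j * k + l) \<noteq> b ! (j * k + l)})"
    by (subst card_image) auto
  also have "(\<lambda>l. j * k + l) ` {l. l < k \<and> a ! (j * k + l) \<noteq> b ! (j * k + l)} =
      {i \<in> {..<r * k}. a ! i \<noteq> b ! i} \<inter> {j * k..<j * k + k}"
  proof (intro set_eqI iffI)
    fix i assume "i \<in> {i \<in> {..<r * k}. a ! i \<noteq> b ! i} \<inter> {j * k..<j * k + k}"
    then show "i \<in> (\<lambda>l. j * k + l) ` {l. l < k \<and> a ! (j * k + l) \<noteq> b ! (j * k + l)}"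
      by (intro image_eqI[of _ _ "i - j * k"]) auto
  qed (use le in auto)
  finally show ?thesis .
qed

text \<open>A balanced permutation puts exactly \<open>2 * h\<close> differences into each block.
  Then each level catches the pair with probability at least \<open>q\<close>, and the tree fails
  with probability at most \<open>r * e\<close>.\<close>

lemma prob_repetition_fail:
  fixes r k h t :: nat
  defines "d \<equiv> r * k" and "q \<equiv> q_val k t h"
  assumes "x \<in> set L1" "y \<in> set L2" "length x = d" "length y = d" "wt (vadd x y) = 2 * r * h"
    and "2 * h \<le> k" "h \<le> t" "(1 - q) ^ N \<le> e" "real r * e \<le> 1"
  shows "measure_pmf.prob (repetition d r k t N (2 * r * h) L1 L2) {z. (x, y) \<notin> fst z}
    \<le> 1 - 1 / real (Suc k) ^ r * (1 - real r * e)"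
proof -
  define D where "D = {i \<in> {..<d}. x ! i \<noteq> y ! i}"
  have D: "D \<subseteq> {..<r * k}" "card D = r * (2 * h)"
  proof -
    have "D = {i. i < length (vadd x y) \<and> vadd x y ! i}" using assms by (auto simp: D_def)
    then show "card D = r * (2 * h)" using assms(7) by (simp add: wt_conv_card)
  qed (auto simp: D_def d_def)
  have q: "0 \<le> q" "q \<le> 1"
    using q_val_le_p_val[OF assms(8,9)] p_val_le_1[of k t] by (auto simp: q_def)
  have e: "0 \<le> e" using q(2) assms(10) by (meson diff_ge_0_iff_ge order_trans zero_le_power)
  let ?S = "\<lambda>\<pi>. {i \<in> {..<r * k}. \<pi> i \<in> D}"
  let ?G = "\<lambda>\<pi>. ?S \<pi> \<in> balanced_sets r k (2 * h)"
  let ?T = "\<lambda>\<pi>. bucket_tree r d k t N (2 * r * h) 0 (map (\<lambda>v. (v, permute_vec d \<pi> v)) L1)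
     (map (\<lambda>v. (v, permute_vec d \<pi> v)) L2)"
  have map: "?T \<pi> \<bind> (\<lambda>x. return_pmf (fst x, snd x + c)) = map_pmf (\<lambda>x. (fst x, snd x + c)) (?T \<pi>)" for \<pi> c
    by (simp add: map_pmf_def)
  show ?thesis
    unfolding repetition_eq map
  proof (rule prob_bind_pmf_le[where G = ?G])
    fix \<pi> assume "\<pi> \<in> set_pmf (pmf_of_set {\<pi>. \<pi> permutes {..<d}})" and good: "?G \<pi>"
    then have \<pi>: "\<pi> permutes {..<d}" by simp
    let ?x = "permute_vec d \<pi> x" and ?y = "permute_vec d \<pi> y"
    have \<pi>d: "\<pi> i < d" if "i < d" for i
      using permutes_in_image[OF \<pi>, of i] that by simp
    \<comment> \<open>The permuted vectors differ at \<open>i\<close> iff the original ones differ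
      at \<open>\<pi> i\<close>, so their difference set is the preimage of
      \<open>D\<close>.\<close>
    have S: "{i \<in> {..<r * k}. ?x ! i \<noteq> ?y ! i} = ?S \<pi>"
      by (intro Collect_cong conj_cong refl) (simp add: D_def \<pi>d flip: d_def)
    have "wt (vadd ?x ?y) = card {i \<in> {..<r * k}. ?x ! i \<noteq> ?y ! i}"
      unfolding wt_conv_card
      by (intro arg_cong[where f = card] Collect_cong) (simp flip: d_def cong: conj_cong)
    then have w: "wt (vadd ?x ?y) = 2 * r * h"
      using good unfolding S by (simp add: balanced_sets_def)
    have "measure_pmf.prob (?T \<pi>) {z. (x, y) \<notin> fst z} \<le> real r * e"
    proof (rule prob_bucket_tree_fail[OF w q assms(10)])
      fix j assume j: "j < r"
      have "wt (vadd (block j k ?x) (block j k ?y)) = 2 * h"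
        using good j by (subst wt_vadd_block[OF _ _ j]) (simp_all only: S, simp_all add: d_def balanced_sets_def)
      then show "q \<le> pair_prob k t (block (0 + j) k ?x) (block (0 + j) k ?y)"
        unfolding q_def using j assms(9) by (intro pair_prob_ge) (auto simp: length_block[of _ r] d_def)
    qed (use assms in auto)
    then show "measure_pmf.prob (map_pmf (\<lambda>x. (fst x, snd x + (length L1 + length L2) * d)) (?T \<pi>)) {z. (x, y) \<notin> fst z} \<le> real r * e"
      by (simp add: vimage_def)
  next
    show "1 / real (Suc k) ^ r \<le> measure_pmf.prob (pmf_of_set {\<pi>. \<pi> permutes {..<d}}) {\<pi>. ?G \<pi>}"
      unfolding d_def using D assms(8) by (rule prob_balanced_permutation)
  qed (use e assms in auto)
qed

section \<open>Amplification over the repetitions\<close>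

lemma bucket_alg_fail:
  "measure_pmf.prob (bucket_alg d r k t N w P L1 L2) {z. xy \<notin> fst z} =
    measure_pmf.prob (repetition d r k t N w L1 L2) {z. xy \<notin> fst z} ^ P"
  unfolding bucket_alg_def by (rule prob_replicate_pmf_Union)

lemma success_prob_ge:
  fixes r k h t n :: nat
  defines "d \<equiv> r * k" and "q \<equiv> q_val k t h"
  assumes "0 < r" "0 < n" "2 * h \<le> k" "h \<le> t" "0 < q" "real r * exp (- real d) \<le> 1"
  shows "1 - (1 - 1 / real (Suc k) ^ r * (1 - real r * exp (- real d))) ^ ((d + 1) ^ (r + 1))
    \<le> success_prob d r h t n"
proof -
  define N where "N = nat \<lceil>real d / q\<rceil>"
  let ?P = "(d + 1) ^ (r + 1)" and ?w = "2 * r * h"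
  let ?u = "1 - 1 / real (Suc k) ^ r * (1 - real r * exp (- real d))"
  have k: "d div r = k" using assms by (simp add: d_def)
  have w: "?w \<le> d" using assms by (simp add: d_def)
  have q1: "q \<le> 1" using q_val_le_p_val[OF assms(5,6)] p_val_le_1[of k t] by (simp add: q_def)
  have "real d / q \<le> real N" unfolding N_def by (rule real_nat_ceiling_ge)
  then have Nq: "real d \<le> real N * q" using assms(7) by (simp add: field_simps)
  have "(1 - q) ^ N \<le> exp (- q) ^ N"
    using q1 exp_ge_add_one_self[of "- q"] by (intro power_mono) auto
  also have "\<dots> = exp (- (real N * q))" by (simp flip: exp_of_nat_mult)
  also have "\<dots> \<le> exp (- real d)" using Nq by simp
  finally have e: "(1 - q) ^ N \<le> exp (- real d)" .
  have eq: "cp_run d r h t n = cp_instance d n ?w \<bind> (\<lambda>z. map_pmf (\<lambda>o'. (snd z \<in> fst o', snd o'))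
      (bucket_alg d r k t N ?w ?P (fst (fst z)) (snd (fst z))))"
    unfolding cp_run_def Let_def k N_def q_def by (simp add: case_prod_beta' map_pmf_def)
  have "measure_pmf.prob (cp_run d r h t n) {z. \<not> fst z} \<le> 1 - 1 * (1 - ?u ^ ?P)"
    unfolding eq
  \<comment> \<open>The failure bound holds for every instance in the support, so no instance has to
    be excluded.\<close>
  proof (rule prob_bind_pmf_le[where G = "\<lambda>_. True"])
    fix z assume "z \<in> set_pmf (cp_instance d n ?w)"
    then obtain x y i j L1 L2 where z: "z = ((L1[i := x], L2[j := y]), (x, y))"
      and xy: "(x, y, i, j) \<in> set_pmf (planted_pmf d n ?w)"
      and L: "L1 \<in> set_pmf (lists_pmf n d)" "L2 \<in> set_pmf (lists_pmf n d)"
      unfolding cp_instance_eq by (auto simp: set_bind_pmf)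
    note pl = planted_pmfD[OF xy w assms(4)]
    have "x \<in> set (L1[i := x])" "y \<in> set (L2[j := y])"
      using pl lists_pmf_length[OF L(1)] lists_pmf_length[OF L(2)] by (auto simp: set_update_memI)
    then have "measure_pmf.prob (repetition d r k t N ?w (L1[i := x]) (L2[j := y])) {z. (x, y) \<notin> fst z} \<le> ?u"
      using pl assms e unfolding d_def q_def by (intro prob_repetition_fail)
    then have "measure_pmf.prob (repetition d r k t N ?w (L1[i := x]) (L2[j := y])) {z. (x, y) \<notin> fst z} ^ ?P \<le> ?u ^ ?P"
      by (intro power_mono) auto
    then show "measure_pmf.prob (map_pmf (\<lambda>o'. (snd z \<in> fst o', snd o'))
      (bucket_alg d r k t N ?w ?P (fst (fst z)) (snd (fst z)))) {z. \<not> fst z} \<le> ?u ^ ?P"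
      unfolding z by (simp add: vimage_def bucket_alg_fail del: power_Suc)
  next
    have "1 / real (Suc k) ^ r * (1 - real r * exp (- real d)) \<le> 1 * 1"
      using assms(8) by (intro mult_mono) (auto simp: one_le_power field_simps simp del: of_nat_Suc)
    then have "0 \<le> ?u" by simp
    then show "0 \<le> ?u ^ ?P" by simp
    have "?u \<le> 1" using assms(8) by simp
    then show "?u ^ ?P \<le> 1" using \<open>0 \<le> ?u\<close> by (intro power_le_one)
  qed simp
  moreover have "measure_pmf.prob (cp_run d r h t n) {z. \<not> fst z} = 1 - success_prob d r h t n"
    using measure_pmf.prob_compl[of "{z. fst z}" "cp_run d r h t n"]
    by (simp add: success_prob_def Compl_eq_Diff_UNIV[symmetric] Collect_neg_eq)
  ultimately show ?thesis by simp
qed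

text \<open>With \<open>?v\<close> the success bound of one repetition, the factor
  \<open>(d + 1) ^ r\<close> of \<open>?P\<close> outweighs both \<open>real (Suc k) ^ r\<close> and
  a constant 2, and the remaining factor \<open>d + 1\<close> yields \<open>d \<le> ?P * ?v\<close>.
  Hence all repetitions fail with probability at most \<open>exp (- d)\<close>.\<close>

lemma success_prob_bound:
  fixes r k h t n :: nat
  defines "d \<equiv> r * k"
  assumes "3 \<le> r" "0 < k" "0 < n" "2 * h \<le> k" "h \<le> t" "0 < q_val k t h"
  shows "1 - real d * exp (- real d) \<le> success_prob d r h t n"
proof -
  have "r * 1 \<le> d" unfolding d_def using assms(3) by (intro mult_le_mono2) simp
  then have d: "real r \<le> real d" "1 \<le> real d" using assms(2) by linarith+
  \<comment> \<open>The difference of the two sides is the square of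
    \<open>d / 2 - 1\<close>.\<close>
  have "2 * real d \<le> (1 + real d / 2)\<^sup>2"
    using sum_squares_ge_zero[of "real d / 2 - 1" 0] by (simp add: power2_eq_square algebra_simps)
  also have "\<dots> \<le> exp (real d / 2) ^ 2"
    by (intro power_mono exp_ge_add_one_self) auto
  also have "\<dots> = exp (real d)" by (simp flip: exp_of_nat_mult)
  finally have "real d * exp (- real d) \<le> 1 / 2"
    by (simp add: exp_minus field_simps)
  then have re: "real r * exp (- real d) \<le> 1 / 2"
    using d(1) by (meson exp_ge_zero mult_right_mono order_trans)
  let ?P = "(d + 1) ^ (r + 1)"
  let ?v = "1 / real (Suc k) ^ r * (1 - real r * exp (- real d))"
  have "?v \<le> 1 * 1"
    using re by (intro mult_mono) (auto simp: one_le_power field_simps simp del: of_nat_Suc)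
  then have v1: "?v \<le> 1" by simp
  have "3 * k \<le> d" unfolding d_def using assms(2) by (rule mult_le_mono1)
  \<comment> \<open>This is where \<open>3 \<le> r\<close> enters:
    \<open>2 * k + 2 \<le> 3 * k + 1\<close> for positive \<open>k\<close>.\<close>
  then have "2 * Suc k \<le> d + 1" using assms(3) by simp
  then have "(2 * real (Suc k)) ^ r \<le> real (d + 1) ^ r"
    by (intro power_mono) linarith+
  then have "2 ^ r * real (Suc k) ^ r \<le> real (d + 1) ^ r" by (simp only: power_mult_distrib)
  moreover have "(2 :: real) ^ 1 * real (Suc k) ^ r \<le> 2 ^ r * real (Suc k) ^ r"
    using assms(2) by (intro mult_right_mono power_increasing) auto
  ultimately have "2 * real (Suc k) ^ r \<le> real (d + 1) ^ r"
    by (simp only: power_one_right)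
  then have "1 \<le> real (d + 1) ^ r * (1 / real (Suc k) ^ r * (1 / 2))"
    by (simp add: field_simps del: of_nat_Suc)
  also have "\<dots> \<le> real (d + 1) ^ r * ?v"
    using re by (intro mult_left_mono) auto
  finally have "real d * 1 \<le> real (d + 1) * (real (d + 1) ^ r * ?v)"
    by (intro mult_mono) auto
  moreover have "real ?P = real (d + 1) * real (d + 1) ^ r"
    by (simp add: algebra_simps)
  ultimately have Pv: "real d \<le> real ?P * ?v" by (simp only: mult.assoc mult_1_right)
  have "(1 - ?v) ^ ?P \<le> exp (- ?v) ^ ?P"
    using v1 exp_ge_add_one_self[of "- ?v"] by (intro power_mono) auto
  also have "\<dots> = exp (- (real ?P * ?v))" by (simp only: exp_of_nat_mult[symmetric] mult_minus_right)
  also have "\<dots> \<le> exp (- real d)" using Pv by simp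
  also have "\<dots> \<le> real d * exp (- real d)" using d(2) by simp
  finally show ?thesis
    using success_prob_ge[of r n h k t] assms re unfolding d_def by simp
qed

subsection \<open>Asymptotics of the running time\<close>

lemma node_count_bounds:
  assumes "1 \<le> N"
  shows "real N ^ m \<le> node_count N m" "node_count N m \<le> real (Suc m) * real N ^ m"
proof -
  show "real N ^ m \<le> node_count N m"
    unfolding node_count_def by (rule member_le_sum) auto
  have "node_count N m \<le> (\<Sum>j\<le>m. real N ^ m)"
    unfolding node_count_def using assms by (intro sum_mono power_increasing) auto
  then show "node_count N m \<le> real (Suc m) * real N ^ m" by simp
qed

text \<open>A geometric sum of ratio \<open>N * p\<close>, which is at least 1, lies between its
  last term and \<open>m\<close> times that term.\<close>

lemma scan_count_bounds:
  assumes "1 \<le> real N * p" "0 \<le> p" "0 < m"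
  shows "real N ^ m * p ^ (m - 1) \<le> scan_count N p m" "scan_count N p m \<le> real m * (real N ^ m * p ^ (m - 1))"
proof -
  have "real N ^ Suc (m - 1) * p ^ (m - 1) \<le> scan_count N p m"
    unfolding scan_count_def using assms
    by (intro member_le_sum[of "m - 1" _ "\<lambda>j. real N ^ Suc j * p ^ j"]) auto
  then show "real N ^ m * p ^ (m - 1) \<le> scan_count N p m" using assms(3) by simp
  have "scan_count N p m = (\<Sum>j<m. real N * (real N * p) ^ j)"
    by (simp add: scan_count_def power_mult_distrib mult.assoc)
  also have "\<dots> \<le> (\<Sum>j<m. real N * (real N * p) ^ (m - 1))"
    using assms by (intro sum_mono mult_left_mono power_increasing) auto
  also have "\<dots> = real m * (real N ^ Suc (m - 1) * p ^ (m - 1))"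
    by (simp add: power_mult_distrib mult.assoc)
  finally show "scan_count N p m \<le> real m * (real N ^ m * p ^ (m - 1))" using assms(3) by simp
qed

text \<open>The three terms of \<open>T\<close> match node creations, scans and comparisons.
  Upwards, rounding of \<open>N\<close> and its factor \<open>d\<close> cost
  \<open>(2 * d) ^ r\<close>, and the repetitions cost \<open>(d + 1) ^ (r + 1)\<close>. The bound
  \<open>M \<le> T\<close> makes \<open>T\<close> exponential in \<open>d\<close>.\<close>

lemma expected_time_time_bound:
  fixes r k h t n :: nat and lam :: real
  defines "d \<equiv> r * k" and "M \<equiv> 2 powr (lam * real (r * k))" and "T \<equiv> time_bound lam (r * k) r h t"
  assumes r: "0 < r" and d: "16 \<le> d" and M: "4 \<le> M" and n: "\<bar>real n - M\<bar> \<le> 1"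
    and h: "2 * h \<le> k" "h \<le> t" and q0: "0 < q_val k t h"
  shows "M \<le> T" "T \<le> expected_time d r h t n"
    "expected_time d r h t n \<le> real (d + 1) ^ (3 * r + 3) * T"
proof -
  define p where "p = p_val k t"
  define q where "q = q_val k t h"
  define N where "N = nat \<lceil>real d / q\<rceil>"
  let ?A = "1 / q ^ r" and ?B = "M * p ^ (r - 1) / q ^ r" and ?C = "(M * p ^ r)\<^sup>2 / q ^ r"
  have k: "r * k div r = k" using r by simp
  have T: "T = max ?A (max ?B ?C)"
    unfolding T_def time_bound_def Let_def k p_def q_def M_def by (simp add: inverse_eq_divide)
  have qp: "0 < q" "q \<le> p" "p \<le> 1"
    using q0 q_val_le_p_val[OF h] p_val_le_1 by (auto simp: p_def q_def)
  have p: "0 < p" and q: "q \<le> 1" using qp by auto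
  have qr: "0 < q ^ r" "q ^ r \<le> 1" using qp q by (auto intro: power_le_one)
  have d1: "1 \<le> real d" using d by linarith
  have n1: "0 < n" "4 \<le> real n + 1" "real n \<le> 2 * M" "M \<le> 2 * real n"
    using n M by (auto simp: abs_if split: if_splits)
  have "q ^ r * 1 \<le> q ^ (r - 1)" using qp q by (simp add: power_decreasing)
  also have "\<dots> \<le> p ^ (r - 1)" using qp by (intro power_mono) auto
  finally have "M * q ^ r \<le> M * p ^ (r - 1)" using M by (intro mult_left_mono) auto
  then have MB: "M \<le> ?B" using qr by (simp add: pos_le_divide_eq)
  then show "M \<le> T" unfolding T by simp
  have T0: "0 < T" using \<open>M \<le> T\<close> M by linarith
  have Nlo: "real d / q \<le> real N" unfolding N_def by (rule real_nat_ceiling_ge)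
  have "1 \<le> real d / q" using qp q d1 by (simp add: pos_le_divide_eq)
  \<comment> \<open>Since \<open>d / q\<close> is at least 1, rounding up costs at most a factor
    2.\<close>
  then have "real N \<le> real d / q + real d / q" unfolding N_def by linarith
  then have Nhi: "real N \<le> 2 * real d / q" by simp
  have N1: "1 \<le> N" using Nlo \<open>1 \<le> real d / q\<close> by linarith
  have "real d * 1 \<le> (real N * q)" using Nlo qp by (simp add: pos_divide_le_eq)
  also have "\<dots> \<le> real N * p" using qp by (intro mult_left_mono) auto
  finally have Np: "1 \<le> real N * p" using d1 by linarith
  have Nrlo: "1 / q ^ r \<le> real N ^ r"
  proof -
    have "1 / q ^ r \<le> real d ^ r / q ^ r" using qr d1 by (intro divide_right_mono one_le_power) auto
    also have "\<dots> = (real d / q) ^ r" by (simp add: power_divide)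
    also have "\<dots> \<le> real N ^ r" using Nlo qp by (intro power_mono) auto
    finally show ?thesis .
  qed
  let ?w = "(2 * real d) ^ r"
  have Nrhi: "real N ^ r \<le> ?w * (1 / q ^ r)"
    using power_mono[OF Nhi, of r] by (simp add: power_divide)
  have w1: "1 \<le> ?w" using d1 by (intro one_le_power) auto
  note bounds = expected_time_bounds[OF r n1(1) h(1), of t, folded d_def q_def p_def, folded N_def]
  let ?F = "fixed_cost d r n N p" and ?P = "real (d + 1) ^ (r + 1)" and ?c = "real d * real N ^ r"
  let ?m = "real (n * n - 1)"
  have m: "?m = real n * real n - 1" using n1(1) by (simp add: of_nat_diff)
  have pr: "0 < p ^ r" "p ^ r \<le> 1" "0 < p ^ (r - 1)" "p ^ (2 * r) = p ^ r * p ^ r"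
    using p qp by (auto intro: power_le_one simp: mult_2 power_add)
  have P1: "1 \<le> ?P" by (intro one_le_power) auto
  have scan0: "0 \<le> scan_count N p r" using p by (intro scan_count_nonneg) auto
  show "T \<le> expected_time d r h t n"
  proof -
    have "?A \<le> ?F + ?c * (?m * p ^ (2 * r))"
      using Nrlo node_count_bounds(1)[OF N1, of r] scan0 p
      unfolding fixed_cost_def by (simp add: add_increasing2)
    moreover have "?B \<le> ?F + ?c * (?m * p ^ (2 * r))"
    proof -
      have "?B = (1 / q ^ r * p ^ (r - 1)) * M" by simp
      also have "\<dots> \<le> (real N ^ r * p ^ (r - 1)) * (2 * real n)"
        using Nrlo M n1 pr qr by (intro mult_mono) auto
      also have "\<dots> \<le> scan_count N p r * (2 * real n)"
        using scan_count_bounds(1)[OF Np _ r] p by (intro mult_right_mono) auto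
      also have "\<dots> \<le> ?F + ?c * (?m * p ^ (2 * r))"
        using p unfolding fixed_cost_def by (simp add: node_count_nonneg)
      finally show ?thesis .
    qed
    moreover have "?C \<le> ?F + ?c * (?m * p ^ (2 * r))"
    proof -
      \<comment> \<open>Replacing \<open>M\<close> by \<open>n\<close> and leaving out the planted
        pair loses a factor 16 in total, which the cost \<open>d\<close> of a comparison
        absorbs.\<close>
      have "M * M \<le> (2 * real n) * (2 * real n)" using n1 M by (intro mult_mono) auto
      also have "\<dots> \<le> 16 * ?m"
      proof -
        have n4: "4 \<le> real n * real n" using mult_mono[of 2 "real n" 2 "real n"] n1 by simp
        have eq: "(2 * real n) * (2 * real n) = 4 * (real n * real n)" by simp
        have "4 * x \<le> 16 * (x - 1)" if "4 \<le> x" for x :: real using that by simp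
        then show ?thesis unfolding m eq using n4 by blast
      qed
      also have "\<dots> \<le> real d * ?m" using d by (intro mult_right_mono) auto
      finally have MM: "M * M \<le> real d * ?m" .
      have "?C = (1 / q ^ r) * (M * M) * (p ^ r * p ^ r)"
        by (simp add: power2_eq_square)
      also have "\<dots> \<le> real N ^ r * (real d * ?m) * (p ^ r * p ^ r)"
        using pr M by (intro mult_right_mono mult_mono[OF Nrlo MM]) auto
      also have "\<dots> = ?c * (?m * p ^ (2 * r))" by (simp add: pr(4))
      also have "\<dots> \<le> ?F + ?c * (?m * p ^ (2 * r))" using p fixed_cost_nonneg by simp
      finally show ?thesis .
    qed
    ultimately have "T \<le> ?F + ?c * (?m * p ^ (2 * r))" unfolding T by simp
    also have "\<dots> \<le> ?P * (?F + ?c * (?m * p ^ (2 * r)))"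
      using mult_right_mono[OF P1, of "?F + ?c * (?m * p ^ (2 * r))"] p fixed_cost_nonneg by simp
    also have "\<dots> \<le> expected_time d r h t n" by (rule bounds(1))
    finally show ?thesis .
  qed
  have TA: "?A \<le> T" and TB: "?B \<le> T" and TC: "?C \<le> T" unfolding T by auto
  have NT: "real N ^ r \<le> ?w * T"
    using Nrhi mult_left_mono[OF TA, of ?w] w1 by linarith
  have rd: "real r \<le> real d" using d unfolding d_def by (cases k) auto
  have wT: "0 \<le> ?w * T" using w1 T0 by simp
  have "node_count N r \<le> real (Suc r) * (?w * T)"
    using node_count_bounds(2)[OF N1, of r] NT by (meson mult_left_mono of_nat_0_le_iff order_trans)
  also have "\<dots> \<le> (2 * real d) * (?w * T)"
    using rd d1 wT by (intro mult_right_mono) auto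
  finally have b1: "node_count N r \<le> (2 * real d) * (?w * T)" .
  have "scan_count N p r * (2 * real n) \<le> (real r * (real N ^ r * p ^ (r - 1))) * (4 * M)"
  proof (rule mult_mono)
    show "2 * real n \<le> 4 * M" using n1 by linarith
  qed (use scan_count_bounds(2)[OF Np _ r] p scan0 in auto)
  also have "\<dots> = (4 * real r) * (real N ^ r * (p ^ (r - 1) * M))" by simp
  also have "\<dots> \<le> (4 * real r) * (?w * (1 / q ^ r) * (p ^ (r - 1) * M))"
    using Nrhi pr M by (intro mult_left_mono mult_right_mono) auto
  also have "\<dots> = (4 * real r) * (?w * ?B)" by simp
  also have "\<dots> \<le> (4 * real d) * (?w * T)"
  proof (rule mult_mono)
    show "?w * ?B \<le> ?w * T" using TB w1 by (intro mult_left_mono) auto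
    show "0 \<le> ?w * ?B" using w1 M MB by (intro mult_nonneg_nonneg) linarith+
  qed (use rd in auto)
  finally have b2: "scan_count N p r * (2 * real n) \<le> (4 * real d) * (?w * T)" .
  have "2 * real n \<le> 4 * M" using n1 by linarith
  then have "2 * real n * real d \<le> 4 * M * real d" by (rule mult_right_mono) simp
  also have "\<dots> = (4 * real d) * M" by simp
  also have "\<dots> \<le> (4 * real d) * (?w * T)"
  proof (rule mult_left_mono)
    have "1 * T \<le> ?w * T" using w1 T0 by (intro mult_right_mono) linarith+
    then show "M \<le> ?w * T" using \<open>M \<le> T\<close> by linarith
  qed simp
  finally have b3: "2 * real n * real d \<le> (4 * real d) * (?w * T)" .
  \<comment> \<open>For the planted pair even the trivial bound \<open>p ^ r \<le> 1\<close> is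
    enough: its comparisons cost at most \<open>d\<close> per leaf.\<close>
  have "?c * p ^ r \<le> ?c * 1" using pr by (intro mult_left_mono) auto
  also have "\<dots> \<le> real d * (?w * T)" using NT by (simp add: mult_left_mono)
  finally have b4: "?c * p ^ r \<le> real d * (?w * T)" .
  have "real n * real n \<le> (2 * M) * (2 * M)" using n1 by (intro mult_mono) auto
  then have mM: "?m \<le> 4 * (M * M)" unfolding m by linarith
  have "?c * (?m * p ^ (2 * r)) \<le> (real d * (?w * (1 / q ^ r))) * ((4 * (M * M)) * p ^ (2 * r))"
    using Nrhi mM pr p qr w1 by (intro mult_mono) auto
  also have "\<dots> = (4 * real d) * (?w * ?C)" by (simp add: power2_eq_square pr(4))
  also have "\<dots> \<le> (4 * real d) * (?w * T)" using TC w1 by (intro mult_left_mono) auto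
  finally have b5: "?c * (?m * p ^ (2 * r)) \<le> (4 * real d) * (?w * T)" .
  \<comment> \<open>The constant is the sum of the five contributions, 2 + 4 + 4 + 1 + 4.\<close>
  have "?F + ?c * (p ^ r + ?m * p ^ (2 * r)) \<le> (15 * real d) * (?w * T)"
    using b1 b2 b3 b4 b5 unfolding fixed_cost_def distrib_left by linarith
  also have "\<dots> \<le> (real (d + 1) * real (d + 1)) * ((real (d + 1) * real (d + 1)) ^ r * T)"
  proof (intro mult_mono)
    show "?w \<le> (real (d + 1) * real (d + 1)) ^ r" using d by (intro power_mono mult_mono) auto
  qed (use d T0 w1 in auto)
  finally have "?P * (?F + ?c * (p ^ r + ?m * p ^ (2 * r))) \<le>
      ?P * ((real (d + 1) * real (d + 1)) * ((real (d + 1) * real (d + 1)) ^ r * T))"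
    using P1 by (intro mult_left_mono) auto
  also have "\<dots> = real (d + 1) ^ (3 * r + 3) * T"
    by (simp add: power_add power_mult_distrib power3_eq_cube numeral_3_eq_3 mult_ac)
  finally show "expected_time d r h t n \<le> real (d + 1) ^ (3 * r + 3) * T"
    using bounds(2) by linarith
qed

section \<open>Limits for growing dimension\<close>

lemma q_val_pos:
  assumes "h \<le> t" "t + h \<le> k"
  shows "0 < q_val k t h"
  using assms by (simp add: q_val_def)

text \<open>With \<open>r\<close> within 1 of its real value, these give \<open>3 \<le> r\<close>,
  then \<open>8 * r \<le> d\<close> and so block size at least 8, and finally
  \<open>4 \<le> 2 powr (lam * d)\<close>.\<close>

lemma eventually_block_params:
  fixes lam :: real
  assumes "0 < lam"
  shows "\<forall>\<^sub>F d in sequentially. 3 \<le> lam * real d / (log 2 (real d))\<^sup>2 - 1"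
    and "\<forall>\<^sub>F d in sequentially. 8 * (lam * real d / (log 2 (real d))\<^sup>2 + 1) \<le> real d"
    and "\<forall>\<^sub>F d in sequentially. 2 \<le> lam * real d"
  using assms by real_asymp+

text \<open>This is the logarithm of the overhead \<open>(d + 1) ^ (3 * r + 3)\<close>, with
  \<open>r\<close> at its upper bound, divided by that of \<open>2 powr (lam * d)\<close>. It is of
  order \<open>1 / ln d\<close>.\<close>

lemma overhead_tendsto_0:
  fixes lam :: real
  assumes "0 < lam"
  shows "(\<lambda>d. (3 * (lam * real d / (log 2 (real d))\<^sup>2 + 1) + 3) * ln (real d + 1) / (lam * real d * ln 2)) \<longlonglongrightarrow> 0"
  using assms by real_asymp

lemma eventually_exp_less_inverse_power:
  "\<forall>\<^sub>F d in sequentially. real d * exp (- real d) < inverse (real d ^ c)"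
proof -
  have "((\<lambda>d. real d ^ Suc c / exp (real d)) \<longlonglongrightarrow> 0)"
    by (rule filterlim_compose[OF tendsto_power_div_exp_0 filterlim_real_sequentially])
  then have "\<forall>\<^sub>F d in sequentially. real d ^ Suc c / exp (real d) < 1"
    by (rule order_tendstoD) simp
  then show ?thesis
    using eventually_gt_at_top[of 0] by eventually_elim (simp add: exp_minus field_simps)
qed

text \<open>The excess exponent is the logarithm of \<open>E / T\<close> over \<open>ln T\<close>.
  The numerator is at most \<open>l * ln b\<close>, and \<open>M \<le> T\<close> replaces the
  denominator by the explicit \<open>ln M\<close>.\<close>

lemma powr_exponent:
  fixes E T M :: real
  assumes "1 < M" "M \<le> T" "T \<le> E" "E \<le> b ^ l * T" "1 \<le> b"
  shows "E = T powr (1 + (ln E / ln T - 1))"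
    and "0 \<le> ln E / ln T - 1" "ln E / ln T - 1 \<le> real l * ln b / ln M"
proof -
  have pos: "0 < T" "0 < E" "0 < ln M" "0 < ln T" "ln M \<le> ln T" "ln T \<le> ln E"
    using assms by (auto simp: ln_le_cancel_iff)
  moreover have "T \<noteq> 1" using assms by simp
  ultimately show "E = T powr (1 + (ln E / ln T - 1))" by (simp add: powr_def)
  show "0 \<le> ln E / ln T - 1" using pos by simp
  have "ln E \<le> ln (b ^ l * T)" using assms pos by (simp add: ln_le_cancel_iff)
  also have "\<dots> = real l * ln b + ln T" using assms pos by (simp add: ln_mult ln_realpow)
  finally have "ln E / ln T \<le> (real l * ln b + ln T) / ln T" using pos by (intro divide_right_mono) auto
  also have "\<dots> = real l * ln b / ln T + 1" using pos by (simp add: add_divide_distrib)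
  also have "real l * ln b / ln T \<le> real l * ln b / ln M"
    using pos assms by (intro divide_left_mono) auto
  finally show "ln E / ln T - 1 \<le> real l * ln b / ln M" by simp
qed

text \<open>Integer parameters within 1 of their real values model the rounding. Limits run along
  \<open>D\<close> because \<open>r d\<close> has to divide \<open>d\<close> and be close to its
  real value at once.\<close>

theorem theorem2:
  fixes \<gamma> lam \<delta> :: real and D :: "nat set" and r h t n :: "nat \<Rightarrow> nat"
  assumes "0 \<le> \<gamma>" "\<gamma> \<le> 1/2" "0 < lam" "lam \<le> 1" "\<gamma>/2 \<le> \<delta>" "\<delta> \<le> 1/2"
    and "infinite D"
    and "\<And>d. d \<in> D \<Longrightarrow> 1 \<le> r d \<and> r d dvd d
            \<and> \<bar>real (r d) - lam * real d / (log 2 (real d))\<^sup>2\<bar> \<le> 1"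
    and "\<And>d. d \<in> D \<Longrightarrow> \<bar>real (h d) - \<gamma> * real (d div r d) / 2\<bar> \<le> 1
            \<and> \<bar>real (t d) - \<delta> * real (d div r d)\<bar> \<le> 1 \<and> h d \<le> t d"
    and "\<And>d. d \<in> D \<Longrightarrow> \<bar>real (n d) - 2 powr (lam * real d)\<bar> \<le> 1"
  shows "(\<forall>\<^sub>F d in sequentially \<sqinter> principal D.
            success_prob d (r d) (h d) (t d) (n d) \<ge> 1 - real d * exp (- real d))
       \<and> (\<forall>c::nat. \<forall>\<^sub>F d in sequentially \<sqinter> principal D.
            1 - success_prob d (r d) (h d) (t d) (n d) < inverse (real d ^ c))
       \<and> (\<exists>\<epsilon> :: nat \<Rightarrow> real. (\<epsilon> \<longlongrightarrow> 0) (sequentially \<sqinter> principal D) \<and>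
            (\<forall>\<^sub>F d in sequentially \<sqinter> principal D.
               expected_time d (r d) (h d) (t d) (n d)
                 = time_bound lam d (r d) (h d) (t d) powr (1 + \<epsilon> d)))"
proof -
  let ?F = "sequentially \<sqinter> principal D"
  let ?g = "\<lambda>d. lam * real d / (log 2 (real d))\<^sup>2"
  let ?E = "\<lambda>d. expected_time d (r d) (h d) (t d) (n d)"
  let ?T = "\<lambda>d. time_bound lam d (r d) (h d) (t d)"
  let ?S = "\<lambda>d. success_prob d (r d) (h d) (t d) (n d)"
  let ?\<epsilon> = "\<lambda>d. ln (?E d) / ln (?T d) - 1"
  let ?u = "\<lambda>d. (3 * (?g d + 1) + 3) * ln (real d + 1) / (lam * real d * ln 2)"
  have ev: "eventually P ?F" if "eventually P sequentially" for P
    using that by (rule filter_leD[OF inf_le1])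
  have "\<forall>\<^sub>F d in ?F. d \<in> D"
    by (simp add: eventually_inf_principal)
  then have main: "\<forall>\<^sub>F d in ?F. 1 - real d * exp (- real d) \<le> ?S d \<and>
      0 \<le> ?\<epsilon> d \<and> ?\<epsilon> d \<le> ?u d \<and> ?E d = ?T d powr (1 + ?\<epsilon> d)"
    using ev[OF eventually_block_params(1)[OF assms(3)]] ev[OF eventually_block_params(2)[OF assms(3)]]
      ev[OF eventually_block_params(3)[OF assms(3)]] ev[OF eventually_ge_at_top[of 16]]
  proof eventually_elim
    case (elim d)
    let ?k = "d div r d"
    note R = assms(8)[OF elim(1)] and H = assms(9)[OF elim(1)] and Nd = assms(10)[OF elim(1)]
    have d: "d = r d * ?k" using R by simp
    have r: "real (r d) \<le> ?g d + 1" "3 \<le> real (r d)" using R elim(2) by linarith+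
    have "8 * real (r d) \<le> real d"
      using mult_left_mono[OF r(1), of 8] elim(3) by (rule order_trans) simp
    then have "r d * 8 \<le> r d * ?k" using d by linarith
    then have k: "8 \<le> ?k" using r(2) by simp
    have "\<gamma> * real ?k \<le> 1 / 2 * real ?k" "\<delta> * real ?k \<le> 1 / 2 * real ?k"
      using assms(2,6) by (intro mult_right_mono; simp)+
    \<comment> \<open>The threshold 8 comes from \<open>t + h\<close>: it is at most three quarters
      of the block size plus 2 for rounding.\<close>
    then have ht: "2 * h d \<le> ?k" "h d \<le> t d" "t d + h d \<le> ?k"
      using H k by linarith+
    have q: "0 < q_val ?k (t d) (h d)" using ht by (intro q_val_pos)
    let ?M = "2 powr (lam * real d)"
    have "(2 :: real) powr 2 \<le> ?M" using elim(4) by (intro powr_mono) auto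
    then have M: "4 \<le> ?M" by simp
    have n: "0 < n d" using M Nd by (cases "n d = 0") auto
    have r0: "3 \<le> r d" "0 < r d" "0 < ?k" using r k by auto
    note succ = success_prob_bound[OF r0(1) r0(3) n ht(1,2) q, folded d]
    note time = expected_time_time_bound[of "r d" ?k lam "n d" "h d" "t d", folded d, OF r0(2) elim(5) M Nd ht(1,2) q]
    have "1 < ?M" "1 \<le> real (d + 1)" using M by auto
    note exponent = powr_exponent[OF this(1) time this(2)]
    have lnM: "ln ?M = lam * real d * ln 2" by (simp add: ln_powr)
    have "real (3 * r d + 3) * ln (real (d + 1)) / ln ?M \<le> ?u d"
      unfolding lnM using r(1) assms(3) by (intro divide_right_mono mult_mono) auto
    then show ?case
      using succ exponent by linarith
  qed
  have succ: "\<forall>\<^sub>F d in ?F. ?S d \<ge> 1 - real d * exp (- real d)"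
    using main by eventually_elim simp
  have "\<forall>\<^sub>F d in ?F. 1 - ?S d < inverse (real d ^ c)" for c :: nat
    using succ ev[OF eventually_exp_less_inverse_power[of c]] by eventually_elim linarith
  moreover have "(?\<epsilon> \<longlongrightarrow> 0) ?F"
  proof (rule tendsto_sandwich[where f = "\<lambda>_. 0" and h = ?u])
    show "(?u \<longlongrightarrow> 0) ?F"
      by (rule tendsto_mono[OF inf_le1 overhead_tendsto_0[OF assms(3)]])
    show "\<forall>\<^sub>F d in ?F. 0 \<le> ?\<epsilon> d" "\<forall>\<^sub>F d in ?F. ?\<epsilon> d \<le> ?u d"
      using main by (eventually_elim, simp)+
  qed simp
  moreover have "\<forall>\<^sub>F d in ?F. ?E d = ?T d powr (1 + ?\<epsilon> d)"
    using main by eventually_elim simp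
  ultimately show ?thesis
    using succ by blast
qed

end
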